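(* Let $(M,\phi,\xi,\eta,g)$ be a $3$-dimensional $(\kappa,\mu,\nu)$-contact metric manifold with $\kappa<1$, and let $\tau$ be its scalar curvature. Then its Riemann curvature tensor can be written as $$R=\left(\frac{\tau}{2}-2\kappa\right)R_1+\left(\frac{\tau}{2}-3\kappa\right)R_3+\mu R_4+\nu R_7,$$ where, for all vector fields $X,Y,Z$ on $M$, $$R_1(X,Y)Z=g(Y,Z)X-g(X,Z)Y,$$ $$R_3(X,Y)Z=\eta(X)\eta(Z)Y-\eta(Y)\eta(Z)X+g(X,Z)\eta(Y)\xi-g(Y,Z)\eta(X)\xi,$$ $$R_4(X,Y)Z=g(Y,Z)hX-g(X,Z)hY+g(hY,Z)X-g(hX,Z)Y,$$ $$R_7(X,Y)Z=g(Y,Z)\phi hX-g(X,Z)\phi hY+g(\phi hY,Z)X-g(\phi hX,Z)Y.$$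
   Context: An almost contact metric manifold $(M,\phi,\xi,\eta,g)$ is an odd-dimensional Riemannian manifold $(M,g)$ with a $(1,1)$-tensor field $\phi$, a vector field $\xi$ and a $1$-form $\eta$ such that $\eta(\xi)=1$, $\phi^2X=-X+\eta(X)\xi$ and $g(\phi X,\phi Y)=g(X,Y)-\eta(X)\eta(Y)$ for all vector fields $X,Y$. It is a contact metric manifold if $d\eta=\Phi$, where $\Phi(X,Y)=g(X,\phi Y)$; the convention is $d\eta(X,Y)=\frac12\left(X\eta(Y)-Y\eta(X)-\eta([X,Y])\right)$, so that $\nabla_X\xi=-\phi X-\phi hX$ holds on a contact metric manifold. Here $h=\frac12 L_\xi\phi$, with $L$ the Lie derivative. Curvature convention: $R(X,Y)Z=\nabla_X\nabla_YZ-\nabla_Y\nabla_XZ-\nabla_{[X,Y]}Z$; $Q$ is the Ricci operator, $g(QY,Z)=\mathrm{tr}(X\mapsto R(X,Y)Z)$, and the scalar curvature is $\tau=\mathrm{tr}\,Q$. A $(\kappa,\mu,\nu)$-contact metric manifold is a contact metric manifold for which there are smooth functions $\kappa,\mu,\nu$ on $M$ such that, for all vector fields $X,Y$, $$R(X,Y)\xi=\kappa\{\eta(Y)X-\eta(X)Y\}+\mu\{\eta(Y)hX-\eta(X)hY\}+\nu\{\eta(Y)\phi hX-\eta(X)\phi hY\}.$$ *)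

theory Defs
  imports "HOL-Analysis.Analysis" "HOL-Library.Function_Algebras"
begin

text \<open>
  Tangent vectors are functionals on real functions and vector fields are functions into
  tangent vectors, so both are added and scaled pointwise.
\<close>

instantiation "fun" :: (type, real_vector) real_vector
begin

definition scaleR_fun :: "real \<Rightarrow> ('a \<Rightarrow> 'b) \<Rightarrow> 'a \<Rightarrow> 'b"
  where "scaleR_fun c f = (\<lambda>x. c *\<^sub>R f x)"

instance
  by standard (auto simp: scaleR_fun_def fun_eq_iff algebra_simps)

end

text \<open>The Euclidean notion; it is only used for open \<open>S\<close>.\<close>

primrec Ck_on :: "'e::euclidean_space set \<Rightarrow> ('e \<Rightarrow> 'b::real_normed_vector) \<Rightarrow> nat \<Rightarrow> bool" where
  "Ck_on S f 0 \<longleftrightarrow> continuous_on S f"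
| "Ck_on S f (Suc k) \<longleftrightarrow>
     (\<forall>x\<in>S. f differentiable (at x)) \<and> (\<forall>v. Ck_on S (\<lambda>x. frechet_derivative f (at x) v) k)"

definition smooth_on :: "'e::euclidean_space set \<Rightarrow> ('e \<Rightarrow> 'b::real_normed_vector) \<Rightarrow> bool"
  where "smooth_on S f \<longleftrightarrow> (\<forall>k. Ck_on S f k)"


section \<open>Smooth manifolds\<close>

text \<open>
  The points of the manifold are all the elements of the type \<open>'a\<close>, with the topology of that
  type.  A chart is a pair of its domain and its coordinate map into the model space \<open>'e\<close>;
  the dimension of the manifold is \<open>DIM('e)\<close>.
\<close>

type_synonym ('a, 'e) chart = "'a set \<times> ('a \<Rightarrow> 'e)"
type_synonym ('a, 'e) atlas = "('a, 'e) chart set"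

definition smooth_manifold ::
    "('a::{t2_space, second_countable_topology}, 'e::euclidean_space) atlas \<Rightarrow> bool"
  where "smooth_manifold A \<longleftrightarrow>
    (\<forall>(U, c)\<in>A. open U \<and> open (c ` U) \<and> homeomorphism U (c ` U) c (inv_into U c)) \<and>
    \<Union> (fst ` A) = UNIV \<and>
    (\<forall>(U, c)\<in>A. \<forall>(V, d)\<in>A. smooth_on (c ` (U \<inter> V)) (d \<circ> inv_into U c))"

definition smooth_fun_on ::
    "('a::topological_space, 'e::euclidean_space) atlas \<Rightarrow> 'a set \<Rightarrow> ('a \<Rightarrow> real) \<Rightarrow> bool"
  where "smooth_fun_on A W f \<longleftrightarrow> (\<forall>(U, c)\<in>A. smooth_on (c ` (U \<inter> W)) (f \<circ> inv_into U c))"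

abbreviation smooth_fun ::
    "('a::topological_space, 'e::euclidean_space) atlas \<Rightarrow> ('a \<Rightarrow> real) \<Rightarrow> bool"
  where "smooth_fun A \<equiv> smooth_fun_on A UNIV"

definition smooth_near ::
    "('a::topological_space, 'e::euclidean_space) atlas \<Rightarrow> 'a \<Rightarrow> ('a \<Rightarrow> real) \<Rightarrow> bool"
  where "smooth_near A p f \<longleftrightarrow> (\<exists>W. open W \<and> p \<in> W \<and> smooth_fun_on A W f)"


section \<open>Tangent vectors and vector fields\<close>

text \<open>
  A tangent vector at \<open>p\<close> is the velocity at \<open>0\<close> of a smooth curve through \<open>p\<close>, regarded as an
  operator on the functions that are smooth near \<open>p\<close>.  Its value on all other functions is
  set to \<open>0\<close>, so that equality of tangent vectors is equality of HOL functions.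
\<close>

type_synonym 'a tvec = "('a \<Rightarrow> real) \<Rightarrow> real"
type_synonym 'a vfield = "'a \<Rightarrow> 'a tvec"

definition smooth_curve ::
    "('a::topological_space, 'e::euclidean_space) atlas \<Rightarrow> (real \<Rightarrow> 'a) \<Rightarrow> bool"
  where "smooth_curve A \<alpha> \<longleftrightarrow>
    (\<exists>\<epsilon>>0. continuous_on {-\<epsilon><..<\<epsilon>} \<alpha> \<and>
      (\<forall>(U, c)\<in>A. smooth_on {t \<in> {-\<epsilon><..<\<epsilon>}. \<alpha> t \<in> U} (c \<circ> \<alpha>)))"

definition velocity ::
    "('a::topological_space, 'e::euclidean_space) atlas \<Rightarrow> (real \<Rightarrow> 'a) \<Rightarrow> 'a tvec"
  where "velocity A \<alpha> = (\<lambda>f. if smooth_near A (\<alpha> 0) f then deriv (f \<circ> \<alpha>) 0 else 0)"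

definition tangent_space ::
    "('a::topological_space, 'e::euclidean_space) atlas \<Rightarrow> 'a \<Rightarrow> 'a tvec set"
  where "tangent_space A p = {velocity A \<alpha> | \<alpha>. smooth_curve A \<alpha> \<and> \<alpha> 0 = p}"

definition vfields :: "('a::topological_space, 'e::euclidean_space) atlas \<Rightarrow> 'a vfield set"
  where "vfields A = {X. (\<forall>p. X p \<in> tangent_space A p) \<and>
    (\<forall>W f. open W \<longrightarrow> smooth_fun_on A W f \<longrightarrow> smooth_fun_on A W (\<lambda>p. X p f))}"

definition fmult :: "('a \<Rightarrow> real) \<Rightarrow> 'a vfield \<Rightarrow> 'a vfield"  (infixr "\<odot>" 75)
  where "f \<odot> X = (\<lambda>p. f p *\<^sub>R X p)"

definition lie_bracket ::
    "('a::topological_space, 'e::euclidean_space) atlas \<Rightarrow> 'a vfield \<Rightarrow> 'a vfield \<Rightarrow> 'a vfield"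
  where "lie_bracket A X Y = (\<lambda>p f.
    if smooth_near A p f then X p (\<lambda>q. Y q f) - Y p (\<lambda>q. X q f) else 0)"


section \<open>Tensor fields\<close>

definition linear_map_on :: "'v::real_vector set \<Rightarrow> ('v \<Rightarrow> 'w::real_vector) \<Rightarrow> bool"
  where "linear_map_on V L \<longleftrightarrow>
    (\<forall>u\<in>V. \<forall>v\<in>V. L (u + v) = L u + L v) \<and> (\<forall>a. \<forall>u\<in>V. L (a *\<^sub>R u) = a *\<^sub>R L u)"

type_synonym 'a endo_field = "'a \<Rightarrow> 'a tvec \<Rightarrow> 'a tvec"
type_synonym 'a form_field = "'a \<Rightarrow> 'a tvec \<Rightarrow> real"
type_synonym 'a bilin_field = "'a \<Rightarrow> 'a tvec \<Rightarrow> 'a tvec \<Rightarrow> real"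

abbreviation appl :: "'a endo_field \<Rightarrow> 'a vfield \<Rightarrow> 'a vfield"
  where "appl \<phi> X \<equiv> (\<lambda>p. \<phi> p (X p))"

abbreviation eval1 :: "'a form_field \<Rightarrow> 'a vfield \<Rightarrow> 'a \<Rightarrow> real"
  where "eval1 \<eta> X \<equiv> (\<lambda>p. \<eta> p (X p))"

abbreviation eval2 :: "'a bilin_field \<Rightarrow> 'a vfield \<Rightarrow> 'a vfield \<Rightarrow> 'a \<Rightarrow> real"
  where "eval2 g X Y \<equiv> (\<lambda>p. g p (X p) (Y p))"

definition tensor11 ::
    "('a::topological_space, 'e::euclidean_space) atlas \<Rightarrow> 'a endo_field \<Rightarrow> bool"
  where "tensor11 A \<phi> \<longleftrightarrow>
    (\<forall>p. \<phi> p ` tangent_space A p \<subseteq> tangent_space A p \<and> linear_map_on (tangent_space A p) (\<phi> p)) \<and>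
    (\<forall>X\<in>vfields A. appl \<phi> X \<in> vfields A)"

definition one_form ::
    "('a::topological_space, 'e::euclidean_space) atlas \<Rightarrow> 'a form_field \<Rightarrow> bool"
  where "one_form A \<eta> \<longleftrightarrow>
    (\<forall>p. linear_map_on (tangent_space A p) (\<eta> p)) \<and>
    (\<forall>X\<in>vfields A. smooth_fun A (eval1 \<eta> X))"

definition riemannian_metric ::
    "('a::topological_space, 'e::euclidean_space) atlas \<Rightarrow> 'a bilin_field \<Rightarrow> bool"
  where "riemannian_metric A g \<longleftrightarrow>
    (\<forall>p. \<forall>u\<in>tangent_space A p.
       linear_map_on (tangent_space A p) (g p u) \<and>
       (\<forall>v\<in>tangent_space A p. g p u v = g p v u) \<and>
       (u \<noteq> 0 \<longrightarrow> g p u u > 0)) \<and>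
    (\<forall>X\<in>vfields A. \<forall>Y\<in>vfields A. smooth_fun A (eval2 g X Y))"

definition d_form ::
    "('a::topological_space, 'e::euclidean_space) atlas \<Rightarrow> 'a form_field \<Rightarrow>
      'a vfield \<Rightarrow> 'a vfield \<Rightarrow> 'a \<Rightarrow> real"
  where "d_form A \<eta> X Y = (\<lambda>p.
    (X p (eval1 \<eta> Y) - Y p (eval1 \<eta> X) - \<eta> p (lie_bracket A X Y p)) / 2)"

definition lie_deriv_endo ::
    "('a::topological_space, 'e::euclidean_space) atlas \<Rightarrow> 'a vfield \<Rightarrow> 'a endo_field \<Rightarrow>
      'a vfield \<Rightarrow> 'a vfield"
  where "lie_deriv_endo A V \<phi> X = lie_bracket A V (appl \<phi> X) - appl \<phi> (lie_bracket A V X)"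


section \<open>Levi-Civita connection and curvature\<close>

type_synonym 'a connection = "'a vfield \<Rightarrow> 'a vfield \<Rightarrow> 'a vfield"

definition affine_connection ::
    "('a::topological_space, 'e::euclidean_space) atlas \<Rightarrow> 'a connection \<Rightarrow> bool"
  where "affine_connection A D \<longleftrightarrow>
    (\<forall>X\<in>vfields A. \<forall>Y\<in>vfields A. D X Y \<in> vfields A) \<and>
    (\<forall>X\<in>vfields A. \<forall>Y\<in>vfields A. \<forall>Z\<in>vfields A.
       D (X + Y) Z = D X Z + D Y Z \<and> D X (Y + Z) = D X Y + D X Z) \<and>
    (\<forall>f. \<forall>X\<in>vfields A. \<forall>Y\<in>vfields A. smooth_fun A f \<longrightarrow>
       D (f \<odot> X) Y = f \<odot> D X Y \<and> D X (f \<odot> Y) = f \<odot> D X Y + (\<lambda>p. X p f) \<odot> Y)"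

definition levi_civita ::
    "('a::topological_space, 'e::euclidean_space) atlas \<Rightarrow> 'a bilin_field \<Rightarrow> 'a connection \<Rightarrow> bool"
  where "levi_civita A g D \<longleftrightarrow> affine_connection A D \<and>
    (\<forall>X\<in>vfields A. \<forall>Y\<in>vfields A. D X Y - D Y X = lie_bracket A X Y) \<and>
    (\<forall>X\<in>vfields A. \<forall>Y\<in>vfields A. \<forall>Z\<in>vfields A. \<forall>p.
       X p (eval2 g Y Z) = g p (D X Y p) (Z p) + g p (Y p) (D X Z p))"

definition curvature ::
    "('a::topological_space, 'e::euclidean_space) atlas \<Rightarrow> 'a connection \<Rightarrow>
      'a vfield \<Rightarrow> 'a vfield \<Rightarrow> 'a vfield \<Rightarrow> 'a vfield"
  where "curvature A D X Y Z = D X (D Y Z) - D Y (D X Z) - D (lie_bracket A X Y) Z"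

text \<open>
  The trace of an endomorphism \<open>L\<close> of a finite-dimensional subspace \<open>V\<close>: the sum of the
  diagonal coefficients of \<open>L\<close> in a basis, which is the same for every basis of \<open>V\<close>.
\<close>

definition endo_trace :: "'v::real_vector set \<Rightarrow> ('v \<Rightarrow> 'v) \<Rightarrow> real"
  where "endo_trace V L =
    (THE t. \<forall>B. independent B \<and> span B = V \<longrightarrow> t = (\<Sum>b\<in>B. representation B (L b) b))"

text \<open>
  A function-linear operator \<open>T\<close> on vector fields induces the endomorphism of the tangent space
  at \<open>p\<close> that sends \<open>v\<close> to \<open>T V p\<close>, for any vector field \<open>V\<close> with value \<open>v\<close> at \<open>p\<close>.
\<close>

definition trace_op ::
    "('a::topological_space, 'e::euclidean_space) atlas \<Rightarrow> ('a vfield \<Rightarrow> 'a vfield) \<Rightarrow> 'a \<Rightarrow> real"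
  where "trace_op A T p =
    endo_trace (tangent_space A p) (\<lambda>v. T (SOME V. V \<in> vfields A \<and> V p = v) p)"

definition ricci_operator ::
    "('a::topological_space, 'e::euclidean_space) atlas \<Rightarrow> 'a bilin_field \<Rightarrow> 'a connection \<Rightarrow>
      'a vfield \<Rightarrow> 'a vfield"
  where "ricci_operator A g D Y = (\<lambda>p. THE w. w \<in> tangent_space A p \<and>
    (\<forall>Z\<in>vfields A. g p w (Z p) = trace_op A (\<lambda>X. curvature A D X Y Z) p))"

definition scalar_curvature ::
    "('a::topological_space, 'e::euclidean_space) atlas \<Rightarrow> 'a bilin_field \<Rightarrow> 'a connection \<Rightarrow>
      'a \<Rightarrow> real"
  where "scalar_curvature A g D = trace_op A (ricci_operator A g D)"


section \<open>Contact metric manifolds\<close>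

definition almost_contact_metric ::
    "('a::{t2_space, second_countable_topology}, 'e::euclidean_space) atlas \<Rightarrow>
      'a endo_field \<Rightarrow> 'a vfield \<Rightarrow> 'a form_field \<Rightarrow> 'a bilin_field \<Rightarrow> bool"
  where "almost_contact_metric (A :: ('a, 'e) atlas) \<phi> \<xi> \<eta> g \<longleftrightarrow>
    smooth_manifold A \<and> odd (DIM('e)) \<and> riemannian_metric A g \<and>
    tensor11 A \<phi> \<and> \<xi> \<in> vfields A \<and> one_form A \<eta> \<and>
    (\<forall>p. \<eta> p (\<xi> p) = 1) \<and>
    (\<forall>X\<in>vfields A. appl \<phi> (appl \<phi> X) = - X + eval1 \<eta> X \<odot> \<xi>) \<and>
    (\<forall>X\<in>vfields A. \<forall>Y\<in>vfields A. \<forall>p.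
       g p (\<phi> p (X p)) (\<phi> p (Y p)) = g p (X p) (Y p) - \<eta> p (X p) * \<eta> p (Y p))"

definition contact_metric ::
    "('a::{t2_space, second_countable_topology}, 'e::euclidean_space) atlas \<Rightarrow>
      'a endo_field \<Rightarrow> 'a vfield \<Rightarrow> 'a form_field \<Rightarrow> 'a bilin_field \<Rightarrow> bool"
  where "contact_metric A \<phi> \<xi> \<eta> g \<longleftrightarrow> almost_contact_metric A \<phi> \<xi> \<eta> g \<and>
    (\<forall>X\<in>vfields A. \<forall>Y\<in>vfields A. d_form A \<eta> X Y = eval2 g X (appl \<phi> Y))"

definition h_op ::
    "('a::topological_space, 'e::euclidean_space) atlas \<Rightarrow> 'a endo_field \<Rightarrow> 'a vfield \<Rightarrow>
      'a vfield \<Rightarrow> 'a vfield"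
  where "h_op A \<phi> \<xi> X = (1/2) *\<^sub>R lie_deriv_endo A \<xi> \<phi> X"

text \<open>The argument \<open>D\<close> is meant to be the Levi-Civita connection of \<open>g\<close>.\<close>

definition kappa_mu_nu_contact_metric ::
    "('a::{t2_space, second_countable_topology}, 'e::euclidean_space) atlas \<Rightarrow>
      'a endo_field \<Rightarrow> 'a vfield \<Rightarrow> 'a form_field \<Rightarrow> 'a bilin_field \<Rightarrow> 'a connection \<Rightarrow>
      ('a \<Rightarrow> real) \<Rightarrow> ('a \<Rightarrow> real) \<Rightarrow> ('a \<Rightarrow> real) \<Rightarrow> bool"
  where "kappa_mu_nu_contact_metric A \<phi> \<xi> \<eta> g D \<kappa> \<mu> \<nu> \<longleftrightarrow>
    contact_metric A \<phi> \<xi> \<eta> g \<and>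
    smooth_fun A \<kappa> \<and> smooth_fun A \<mu> \<and> smooth_fun A \<nu> \<and>
    (\<forall>X\<in>vfields A. \<forall>Y\<in>vfields A. let h = h_op A \<phi> \<xi> in
       curvature A D X Y \<xi> =
         \<kappa> \<odot> (eval1 \<eta> Y \<odot> X - eval1 \<eta> X \<odot> Y)
       + \<mu> \<odot> (eval1 \<eta> Y \<odot> h X - eval1 \<eta> X \<odot> h Y)
       + \<nu> \<odot> (eval1 \<eta> Y \<odot> appl \<phi> (h X) - eval1 \<eta> X \<odot> appl \<phi> (h Y)))"

definition R1 :: "'a bilin_field \<Rightarrow> 'a vfield \<Rightarrow> 'a vfield \<Rightarrow> 'a vfield \<Rightarrow> 'a vfield"
  where "R1 g X Y Z = eval2 g Y Z \<odot> X - eval2 g X Z \<odot> Y"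

definition R3 ::
    "'a vfield \<Rightarrow> 'a form_field \<Rightarrow> 'a bilin_field \<Rightarrow> 'a vfield \<Rightarrow> 'a vfield \<Rightarrow> 'a vfield \<Rightarrow> 'a vfield"
  where "R3 \<xi> \<eta> g X Y Z =
      eval1 \<eta> X \<odot> eval1 \<eta> Z \<odot> Y - eval1 \<eta> Y \<odot> eval1 \<eta> Z \<odot> X
    + eval2 g X Z \<odot> eval1 \<eta> Y \<odot> \<xi> - eval2 g Y Z \<odot> eval1 \<eta> X \<odot> \<xi>"

definition R4 ::
    "('a::topological_space, 'e::euclidean_space) atlas \<Rightarrow> 'a endo_field \<Rightarrow> 'a vfield \<Rightarrow>
      'a bilin_field \<Rightarrow> 'a vfield \<Rightarrow> 'a vfield \<Rightarrow> 'a vfield \<Rightarrow> 'a vfield"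
  where "R4 A \<phi> \<xi> g X Y Z = (let h = h_op A \<phi> \<xi> in
      eval2 g Y Z \<odot> h X - eval2 g X Z \<odot> h Y + eval2 g (h Y) Z \<odot> X - eval2 g (h X) Z \<odot> Y)"

definition R7 ::
    "('a::topological_space, 'e::euclidean_space) atlas \<Rightarrow> 'a endo_field \<Rightarrow> 'a vfield \<Rightarrow>
      'a bilin_field \<Rightarrow> 'a vfield \<Rightarrow> 'a vfield \<Rightarrow> 'a vfield \<Rightarrow> 'a vfield"
  where "R7 A \<phi> \<xi> g X Y Z = (let k = (\<lambda>V. appl \<phi> (h_op A \<phi> \<xi> V)) in
      eval2 g Y Z \<odot> k X - eval2 g X Z \<odot> k Y + eval2 g (k Y) Z \<odot> X - eval2 g (k X) Z \<odot> Y)"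

end

(*
  Both sides are function-linear in X, Y and Z, so they only have to be compared on one frame at
  each point p.  The frame is (xi, E, phi E) for a global field E that is everywhere orthogonal to
  xi and of unit length at p: these three fields are orthogonal everywhere, with squared lengths
  1, r and r, where r = g(E, E), so that

    r X = r eta(X) xi + g(X, E) E + g(X, phi E) phi E

  holds on all of M, also where E vanishes; no local frame is needed.  In dimension 3 the skew
  symmetries leave six components of R.  The formula for R(X, Y) xi and the pair symmetry give all
  of them but g(R(E, phi E) phi E, E), and this one is determined by the scalar curvature, since
  h and phi h are trace-free because h anticommutes with phi.
*)
theory Submission
  imports Defs
begin

section \<open>Calculus of smooth maps\<close>

text \<open>The connection, the curvature and \<open>h_op\<close> act on fields defined on the whole
  manifold, and a tangent vector is a functional that comes from a curve, so neither linearity nor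
  dependence on the value at one point is built in. Charts give the tangent spaces their linear
  structure and dimension, a bump function extends each tangent vector to a global field, and every
  operator is shown to be function-linear before it is compared on a frame.

  Origin of the coefficients: \<open>R3\<close> agrees with -\<open>R1\<close> when the last
  argument is \<xi>, so the formula for R(X,Y)\<xi> fixes only the difference of the first two
  coefficients, which is \<kappa>. On arguments orthogonal to \<xi>, \<open>R3\<close> vanishes, and
  the coefficient of \<open>R1\<close> is the sectional curvature of the plane of E and \<phi>E. The
  scalar curvature is twice the sum of the sectional curvatures of the three frame planes, and the
  two planes through \<xi> contribute 2\<kappa> to that sum; this leaves \<tau>/2 - 2\<kappa>.

  That h anticommutes with \<phi> comes from differentiating \<phi>\<phi>X = -X + \<eta>(X)\<xi>
  along \<xi>, once the contact condition has given L_\<xi> \<eta> = 0.\<close>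

lemma Ck_on_cong:
  assumes "open S" "\<And>x. x \<in> S \<Longrightarrow> f x = g x" "Ck_on S f k"
  shows "Ck_on S g k"
  using assms(2,3)
proof (induction k arbitrary: f g)
  case 0
  then show ?case by (simp cong: continuous_on_cong)
next
  case (Suc k)
  have D: "(f has_derivative f') (at x) \<Longrightarrow> (g has_derivative f') (at x)" if "x \<in> S" for x f'
    using has_derivative_transform_within_open[of f f' x UNIV S g] that assms(1) Suc.prems(1) by auto
  have "g differentiable at x" if "x \<in> S" for x
    using D[OF that] Suc.prems(2) that unfolding Ck_on.simps differentiable_def by meson
  moreover have "frechet_derivative f (at x) = frechet_derivative g (at x)" if "x \<in> S" for x
    using D[OF that] Suc.prems(2) that frechet_derivative_at frechet_derivative_works
    by (metis Ck_on.simps(2))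
  ultimately show ?case
    using Suc.prems(2) Suc.IH[of "\<lambda>x. frechet_derivative f (at x) _" "\<lambda>x. frechet_derivative g (at x) _"]
    by auto
qed

lemma Ck_on_subset: "Ck_on S f k \<Longrightarrow> T \<subseteq> S \<Longrightarrow> Ck_on T f k"
  by (induction k arbitrary: f) (auto intro: continuous_on_subset)

text \<open>The successor clause of \<open>Ck_on\<close> does not ask for continuity of
  \<open>f\<close> itself; the base case recovers it from differentiability.\<close>

lemma Ck_on_SucD: "Ck_on S f (Suc k) \<Longrightarrow> Ck_on S f k"
proof (induction k arbitrary: f)
  case 0
  then show ?case
    by (simp add: differentiable_imp_continuous_on differentiable_at_imp_differentiable_on)
next
  case (Suc k)
  then show ?case by simp
qed

lemma Ck_on_local:
  assumes "\<And>x. x \<in> S \<Longrightarrow> \<exists>T. open T \<and> x \<in> T \<and> Ck_on T f k"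
  shows "Ck_on S f k"
  using assms
proof (induction k arbitrary: f)
  case 0
  then show ?case
    by (metis Ck_on.simps(1) continuous_at_imp_continuous_on continuous_on_eq_continuous_at)
next
  case (Suc k)
  have "f differentiable (at x)" if "x \<in> S" for x
    using Suc.prems[OF that] by auto
  moreover have "Ck_on S (\<lambda>x. frechet_derivative f (at x) v) k" for v
    by (rule Suc.IH) (use Suc.prems in fastforce)
  ultimately show ?case by simp
qed

lemma Ck_on_const: "Ck_on S (\<lambda>x. c) k"
  by (induction k arbitrary: c) (auto simp: frechet_derivative_const)

lemma Ck_on_linear:
  assumes "bounded_linear L"
  shows "Ck_on S L k"
proof (cases k)
  case 0
  then show ?thesis using assms by (auto simp: linear_continuous_on)
next
  case (Suc j)
  have "frechet_derivative L (at x) = L" for x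
    using assms by (metis frechet_derivative_at bounded_linear_imp_has_derivative)
  then show ?thesis
    using assms Suc by (auto simp: bounded_linear_imp_differentiable Ck_on_const)
qed


lemma Ck_on_add:
  assumes "open S" "Ck_on S f k" "Ck_on S g k"
  shows "Ck_on S (\<lambda>x. f x + g x) k"
  using assms(2,3)
proof (induction k arbitrary: f g)
  case 0
  then show ?case by (auto intro: continuous_on_add)
next
  case (Suc k)
  have D: "((\<lambda>x. f x + g x) has_derivative
      (\<lambda>v. frechet_derivative f (at x) v + frechet_derivative g (at x) v)) (at x)" if "x \<in> S" for x
    using Suc.prems that by (intro has_derivative_add) (auto simp flip: frechet_derivative_works)
  have "Ck_on S (\<lambda>x. frechet_derivative (\<lambda>x. f x + g x) (at x) v) k" for v
    by (rule Ck_on_cong[OF assms(1) _ Suc.IH[of "\<lambda>x. frechet_derivative f (at x) v" "\<lambda>x. frechet_derivative g (at x) v"]])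
      (use Suc.prems frechet_derivative_at[OF D, symmetric] in auto)
  then show ?case using D by (auto simp: differentiable_def)
qed

text \<open>The product rule brings back \<open>f\<close> and \<open>g\<close> undifferentiated, so
  the induction also needs them one order lower, hence \<open>Ck_on_SucD\<close>. Stating it for any
  bounded bilinear map covers products, scalar multiples and inner products at once.\<close>

lemma Ck_on_bilinear:
  assumes "bounded_bilinear bop" "open S" "Ck_on S f k" "Ck_on S g k"
  shows "Ck_on S (\<lambda>x. bop (f x) (g x)) k"
  using assms(3,4)
proof (induction k arbitrary: f g)
  case 0
  then show ?case by (auto intro: bounded_bilinear.continuous_on[OF assms(1)])
next
  case (Suc k)
  have D: "((\<lambda>x. bop (f x) (g x)) has_derivative
      (\<lambda>v. bop (f x) (frechet_derivative g (at x) v) + bop (frechet_derivative f (at x) v) (g x))) (at x)"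
    if "x \<in> S" for x
    using Suc.prems that
    by (intro bounded_bilinear.FDERIV[OF assms(1)]) (auto simp flip: frechet_derivative_works)
  have "Ck_on S (\<lambda>x. frechet_derivative (\<lambda>x. bop (f x) (g x)) (at x) v) k" for v
    by (rule Ck_on_cong[OF assms(2) _ Ck_on_add[OF assms(2)
          Suc.IH[of f "\<lambda>x. frechet_derivative g (at x) v"] Suc.IH[of "\<lambda>x. frechet_derivative f (at x) v" g]]])
      (use Suc.prems Ck_on_SucD frechet_derivative_at[OF D, symmetric] in auto)
  then show ?case using D by (auto simp: differentiable_def)
qed

lemma Ck_on_sum:
  assumes "open S" "finite I" "\<And>i. i \<in> I \<Longrightarrow> Ck_on S (f i) k"
  shows "Ck_on S (\<lambda>x. \<Sum>i\<in>I. f i x) k"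
  using assms(2,3) by (induction I rule: finite_induct) (auto intro: Ck_on_const Ck_on_add[OF assms(1)])

lemma Ck_on_compose:
  fixes f :: "'a::euclidean_space \<Rightarrow> 'b::euclidean_space"
    and g :: "'b \<Rightarrow> 'c::real_normed_vector"
  assumes S: "open S" and T: "f ` S \<subseteq> T" and "Ck_on S f k" "Ck_on T g k"
  shows "Ck_on S (g \<circ> f) k"
  using assms(3,4)
proof (induction k arbitrary: g)
  case 0
  then show ?case
    unfolding Ck_on.simps using continuous_on_compose continuous_on_subset[OF _ T] by blast
next
  case (Suc k)
  have D: "((g \<circ> f) has_derivative
      (\<lambda>v. frechet_derivative g (at (f x)) (frechet_derivative f (at x) v))) (at x)" if "x \<in> S" for x
  proof -
    have "f differentiable (at x)" "g differentiable (at (f x))"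
      using Suc.prems that T by auto
    then have "(g \<circ> f has_derivative frechet_derivative g (at (f x)) \<circ> frechet_derivative f (at x)) (at x)"
      unfolding frechet_derivative_works by (rule diff_chain_at)
    then show ?thesis by (simp only: o_def)
  qed
  \<comment> \<open>In the chain rule the direction in which \<open>g\<close> is differentiated
    moves with \<open>x\<close>, whereas \<open>Ck_on\<close> speaks of fixed directions. Expanding
    it in \<open>Basis\<close> leaves derivatives of \<open>g\<close> in fixed directions, composed
    with \<open>f\<close>, to which the induction hypothesis applies.\<close>
  have sum: "frechet_derivative g (at (f x)) (frechet_derivative f (at x) v) =
      (\<Sum>b\<in>Basis. (frechet_derivative f (at x) v \<bullet> b) *\<^sub>R ((\<lambda>y. frechet_derivative g (at y) b) \<circ> f) x)"
    if "x \<in> S" for x v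
  proof -
    have "linear (frechet_derivative g (at (f x)))"
      using Suc.prems(2) that T by (intro linear_frechet_derivative) auto
    then have "frechet_derivative g (at (f x)) (\<Sum>b\<in>Basis. (u \<bullet> b) *\<^sub>R b) =
        (\<Sum>b\<in>Basis. (u \<bullet> b) *\<^sub>R frechet_derivative g (at (f x)) b)" for u
      by (simp only: linear_sum linear_cmul)
    then show ?thesis unfolding euclidean_representation o_def .
  qed
  have C: "Ck_on S (\<lambda>x. frechet_derivative f (at x) v \<bullet> b) k" for v b
    by (rule Ck_on_bilinear[OF bounded_bilinear_inner S _ Ck_on_const]) (use Suc.prems(1) in simp)
  have "Ck_on S (\<lambda>x. \<Sum>b\<in>Basis. (frechet_derivative f (at x) v \<bullet> b) *\<^sub>R
      ((\<lambda>y. frechet_derivative g (at y) b) \<circ> f) x) k" for v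
  proof (rule Ck_on_sum[OF S finite_Basis])
    fix b :: 'b
    have "Ck_on S ((\<lambda>y. frechet_derivative g (at y) b) \<circ> f) k"
      by (rule Suc.IH[OF Ck_on_SucD[OF Suc.prems(1)]]) (use Suc.prems(2) in simp)
    from Ck_on_bilinear[OF bounded_bilinear_scaleR S C this]
    show "Ck_on S (\<lambda>x. (frechet_derivative f (at x) v \<bullet> b) *\<^sub>R
        ((\<lambda>y. frechet_derivative g (at y) b) \<circ> f) x) k" .
  qed
  then have "Ck_on S (\<lambda>x. frechet_derivative (g \<circ> f) (at x) v) k" for v
    by (rule Ck_on_cong[OF S, rotated]) (simp only: sum frechet_derivative_at[OF D, symmetric])
  then show ?case using D unfolding Ck_on.simps differentiable_def by blast
qed

lemma smooth_on_cong:
  "open S \<Longrightarrow> (\<And>x. x \<in> S \<Longrightarrow> f x = g x) \<Longrightarrow> smooth_on S f \<Longrightarrow> smooth_on S g"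
  unfolding smooth_on_def using Ck_on_cong by blast

lemma smooth_on_subset: "smooth_on S f \<Longrightarrow> T \<subseteq> S \<Longrightarrow> smooth_on T f"
  unfolding smooth_on_def using Ck_on_subset by blast

lemma smooth_on_local:
  "(\<And>x. x \<in> S \<Longrightarrow> \<exists>T. open T \<and> x \<in> T \<and> smooth_on T f) \<Longrightarrow> smooth_on S f"
  unfolding smooth_on_def by (meson Ck_on_local)

lemma smooth_on_const: "smooth_on S (\<lambda>x. c)"
  unfolding smooth_on_def using Ck_on_const by blast

lemma smooth_on_linear: "bounded_linear L \<Longrightarrow> smooth_on S L"
  unfolding smooth_on_def using Ck_on_linear by blast

lemma smooth_on_add:
  "open S \<Longrightarrow> smooth_on S f \<Longrightarrow> smooth_on S g \<Longrightarrow> smooth_on S (\<lambda>x. f x + g x)"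
  unfolding smooth_on_def using Ck_on_add by blast

lemma smooth_on_bilinear:
  "bounded_bilinear bop \<Longrightarrow> open S \<Longrightarrow> smooth_on S f \<Longrightarrow> smooth_on S g \<Longrightarrow>
    smooth_on S (\<lambda>x. bop (f x) (g x))"
  unfolding smooth_on_def using Ck_on_bilinear by blast

lemma smooth_on_compose:
  fixes f :: "'a::euclidean_space \<Rightarrow> 'b::euclidean_space"
  shows "open S \<Longrightarrow> f ` S \<subseteq> T \<Longrightarrow> smooth_on S f \<Longrightarrow> smooth_on T g \<Longrightarrow> smooth_on S (g \<circ> f)"
  unfolding smooth_on_def using Ck_on_compose[of S f T] by metis

lemma smooth_on_imp_differentiable: "smooth_on S f \<Longrightarrow> x \<in> S \<Longrightarrow> f differentiable (at x)"
  unfolding smooth_on_def by (metis Ck_on.simps(2))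

lemma smooth_on_frechet_derivative:
  "smooth_on S f \<Longrightarrow> smooth_on S (\<lambda>x. frechet_derivative f (at x) v)"
  unfolding smooth_on_def by (metis Ck_on.simps(2))

text \<open>\<open>flat 0\<close> is the classical smooth function exp(-1/s), continued by 0, from
  which bump functions are made. The powers of 1/s make the family closed under differentiation up
  to linear combinations, so that smoothness can be shown for all \<open>n\<close> by one
  induction.\<close>

definition flat :: "nat \<Rightarrow> real \<Rightarrow> real"
  where "flat n s = (if s > 0 then (1 / s) ^ n * exp (- (1 / s)) else 0)"

lemma has_derivative_flat:
  "(flat n has_real_derivative (flat (n + 2) s - n * flat (n + 1) s)) (at s)"
proof -
  consider "s > 0" | "s < 0" | "s = 0" by linarith
  then show ?thesis
  proof cases
    case 1
    have "((\<lambda>s. (1 / s) ^ n * exp (- (1 / s))) has_real_derivative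
        (flat (n + 2) s - n * flat (n + 1) s)) (at s)"
      apply (rule derivative_eq_intros refl | use 1 in force)+
      using 1 by (cases n) (auto simp: flat_def field_simps power2_eq_square)
    then show ?thesis
      by (rule has_field_derivative_transform_within_open[where S = "{0<..}"])
        (use 1 in \<open>auto simp: flat_def\<close>)
  next
    case 2
    have "((\<lambda>_. 0) has_real_derivative 0) (at s)" by simp
    then have "(flat n has_real_derivative 0) (at s)"
      by (rule has_field_derivative_transform_within_open[where S = "{..<0}"])
        (use 2 in \<open>auto simp: flat_def\<close>)
    then show ?thesis using 2 by (simp add: flat_def)
  next
    case 3
    \<comment> \<open>The difference quotient at 0 is treated on each side. On the right, with x =
      1/h, it is x^(n+1) / exp x, which tends to 0 as x grows; on the left it is constantly
      0.\<close>
    have "((\<lambda>h. flat n h / h) \<longlongrightarrow> 0) (at_right 0)"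
    proof -
      have "((\<lambda>h. (1 / h) ^ Suc n * exp (- (1 / h))) \<longlongrightarrow> (0::real)) (at_right 0)"
        using filterlim_compose[OF tendsto_power_div_exp_0[of "Suc n"] filterlim_inverse_at_top_right]
        by (simp add: exp_minus divide_simps)
      then show ?thesis
        by (rule Lim_transform_eventually)
          (auto simp: eventually_at_filter flat_def intro!: always_eventually)
    qed
    moreover have "((\<lambda>h. flat n h / h) \<longlongrightarrow> 0) (at_left 0)"
      by (rule Lim_transform_eventually[OF tendsto_const])
        (auto simp: eventually_at_filter flat_def)
    ultimately have "((\<lambda>h. flat n h / h) \<longlongrightarrow> 0) (at 0)"
      using filterlim_split_at by blast
    then show ?thesis using 3 by (simp add: DERIV_def flat_def)
  qed
qed

lemma smooth_on_flat: "smooth_on S (flat n)"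
proof -
  have D: "frechet_derivative (flat n) (at s) = (\<lambda>v. (flat (n + 2) s - n * flat (n + 1) s) * v)" for n s
    using has_derivative_flat[of n s] by (metis frechet_derivative_at has_field_derivative_def)
  have "Ck_on UNIV (flat n) k" for k
  proof (induction k arbitrary: n)
    case 0
    then show ?case
      by (auto intro!: DERIV_continuous_on DERIV_subset[OF has_derivative_flat])
  next
    case (Suc k)
    have "Ck_on UNIV (\<lambda>s. (flat (n + 2) s + (- real n) * flat (n + 1) s) * v) k" for v
      by (intro Ck_on_bilinear[OF bounded_bilinear_mult] Ck_on_add Ck_on_const Suc) auto
    then show ?case
      using has_derivative_flat by (auto simp: D differentiable_def has_field_derivative_def)
  qed
  then show ?thesis by (auto simp: smooth_on_def intro: Ck_on_subset)
qed

lemma smooth_bump: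
  fixes a :: "'e::euclidean_space"
  assumes "r > 0"
  obtains \<beta> :: "'e \<Rightarrow> real"
  where "smooth_on UNIV \<beta>" "\<beta> a = 1" "\<And>x. x \<notin> cball a r \<Longrightarrow> \<beta> x = 0"
proof
  \<comment> \<open>\<open>m\<close> is positive exactly on the open ball of radius \<open>r\<close>
    about \<open>a\<close>, so \<open>flat 0\<close> of it vanishes elsewhere; the factor in \<beta>
    divides by the value at the centre.\<close>
  define m where "m = (\<lambda>x. r\<^sup>2 + (-1) * ((x + - a) \<bullet> (x + - a)))"
  define \<beta> where "\<beta> = (\<lambda>x. (flat 0 \<circ> m) x * inverse (flat 0 (r\<^sup>2)))"
  have *: "smooth_on UNIV (\<lambda>x. x + - a)"
    by (rule smooth_on_add[OF open_UNIV smooth_on_linear[OF bounded_linear_ident] smooth_on_const])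
  have m: "smooth_on UNIV m"
    unfolding m_def
    by (rule smooth_on_add[OF open_UNIV smooth_on_const
          smooth_on_bilinear[OF bounded_bilinear_mult open_UNIV smooth_on_const
            smooth_on_bilinear[OF bounded_bilinear_inner open_UNIV * *]]])
  show "smooth_on UNIV \<beta>"
    unfolding \<beta>_def
    by (rule smooth_on_bilinear[OF bounded_bilinear_mult open_UNIV
          smooth_on_compose[OF open_UNIV subset_UNIV m smooth_on_flat] smooth_on_const])
  show "\<beta> a = 1" using assms by (simp add: \<beta>_def m_def flat_def)
  show "\<beta> x = 0" if "x \<notin> cball a r" for x
  proof -
    have "r\<^sup>2 \<le> (norm (x - a))\<^sup>2"
      using that assms by (intro power_mono) (auto simp: dist_norm norm_minus_commute)
    then show ?thesis by (simp add: \<beta>_def m_def flat_def dot_square_norm)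
  qed
qed

section \<open>Tangent spaces of a manifold\<close>

lemma smooth_fun_onD:
  "smooth_fun_on A W f \<Longrightarrow> (U, c) \<in> A \<Longrightarrow> smooth_on (c ` (U \<inter> W)) (f \<circ> inv_into U c)"
  unfolding smooth_fun_on_def by blast

lemma smooth_fun_on_subset: "smooth_fun_on A W f \<Longrightarrow> W' \<subseteq> W \<Longrightarrow> smooth_fun_on A W' f"
  unfolding smooth_fun_on_def by (fastforce intro: smooth_on_subset)

lemma smooth_fun_on_const: "smooth_fun_on A W (\<lambda>q. c)"
  unfolding smooth_fun_on_def by (auto simp: o_def smooth_on_const)

lemma smooth_nearI: "smooth_fun_on A W f \<Longrightarrow> open W \<Longrightarrow> p \<in> W \<Longrightarrow> smooth_near A p f"
  unfolding smooth_near_def by blast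

lemma smooth_near_eventually:
  assumes "smooth_near A p f"
  obtains W where "open W" "p \<in> W" "\<And>q. q \<in> W \<Longrightarrow> smooth_near A q f"
  using assms unfolding smooth_near_def by blast

lemma smooth_fun_imp_smooth_near: "smooth_fun A f \<Longrightarrow> smooth_near A p f"
  by (rule smooth_nearI) auto

text \<open>The directional derivative in a chart, with the constant coordinate vector
  \<open>w\<close>. The value 0 on functions that are not smooth near \<open>q\<close> matches the
  convention in \<open>velocity\<close>, so that equality of functionals can hold.\<close>

definition chart_vec ::
    "('a::topological_space, 'e::euclidean_space) atlas \<Rightarrow> 'a set \<Rightarrow> ('a \<Rightarrow> 'e) \<Rightarrow> 'e \<Rightarrow> 'a vfield"
  where "chart_vec A U c w q = (\<lambda>f. if smooth_near A q f
    then frechet_derivative (f \<circ> inv_into U c) (at (c q)) w else 0)"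

locale smooth_mfd =
  fixes A :: "('a::{t2_space, second_countable_topology}, 'e::euclidean_space) atlas"
  assumes smooth_manifold: "smooth_manifold A"
begin

lemma
  assumes "(U, c) \<in> A"
  shows open_chart: "open U" and open_chart_range: "open (c ` U)"
    and homeo_chart: "homeomorphism U (c ` U) c (inv_into U c)"
  using smooth_manifold assms unfolding smooth_manifold_def by auto

lemma smooth_transition:
  assumes "(U, c) \<in> A" "(V, d) \<in> A"
  shows "smooth_on (c ` (U \<inter> V)) (d \<circ> inv_into U c)"
  using smooth_manifold assms unfolding smooth_manifold_def by blast

lemma obtain_chart:
  obtains U c where "(U, c) \<in> A" "q \<in> U"
proof -
  have "q \<in> \<Union> (fst ` A)" using smooth_manifold by (simp add: smooth_manifold_def)
  then show ?thesis using that by auto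
qed

lemma chart_inv [simp]: "(U, c) \<in> A \<Longrightarrow> q \<in> U \<Longrightarrow> inv_into U c (c q) = q"
  by (rule homeomorphism_apply1[OF homeo_chart])

lemma open_chart_image:
  assumes "(U, c) \<in> A" "open W"
  shows "open (c ` (U \<inter> W))"
  using homeomorphism_imp_open_map[OF homeo_chart[OF assms(1)], of "U \<inter> W"]
    open_chart_range[OF assms(1)] openin_open_trans assms(2) by (auto simp: openin_open_Int)

lemma smooth_fun_on_local:
  assumes "open W" "\<And>q. q \<in> W \<Longrightarrow> \<exists>W'. open W' \<and> q \<in> W' \<and> smooth_fun_on A W' f"
  shows "smooth_fun_on A W f"
  unfolding smooth_fun_on_def
proof clarify
  fix U c assume C: "(U, c) \<in> A"
  show "smooth_on (c ` (U \<inter> W)) (f \<circ> inv_into U c)"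
  proof (rule smooth_on_local, clarify)
    fix q assume q: "q \<in> U" "q \<in> W"
    then obtain W' where "open W'" "q \<in> W'" "smooth_fun_on A W' f" using assms(2) by blast
    then show "\<exists>T. open T \<and> c q \<in> T \<and> smooth_on T (f \<circ> inv_into U c)"
      using C q open_chart_image[OF C] unfolding smooth_fun_on_def
      by (intro exI[of _ "c ` (U \<inter> W')"]) auto
  qed
qed

lemma smooth_fun_on_cong:
  assumes "open W" "smooth_fun_on A W f" "\<And>q. q \<in> W \<Longrightarrow> f q = g q"
  shows "smooth_fun_on A W g"
  unfolding smooth_fun_on_def
proof clarify
  fix U c assume C: "(U, c) \<in> A"
  show "smooth_on (c ` (U \<inter> W)) (g \<circ> inv_into U c)"
    by (rule smooth_on_cong[of _ "f \<circ> inv_into U c"])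
      (use assms C open_chart_image in \<open>auto simp: smooth_fun_on_def\<close>)
qed

lemma smooth_fun_on_bilinear:
  assumes "bounded_bilinear bop" "open W" "smooth_fun_on A W f" "smooth_fun_on A W g"
  shows "smooth_fun_on A W (\<lambda>q. bop (f q) (g q))"
  unfolding smooth_fun_on_def
proof clarify
  fix U c assume C: "(U, c) \<in> A"
  have "smooth_on (c ` (U \<inter> W)) (\<lambda>x. bop ((f \<circ> inv_into U c) x) ((g \<circ> inv_into U c) x))"
    by (rule smooth_on_bilinear[OF assms(1) open_chart_image[OF C assms(2)]
          smooth_fun_onD[OF assms(3) C] smooth_fun_onD[OF assms(4) C]])
  then show "smooth_on (c ` (U \<inter> W)) ((\<lambda>q. bop (f q) (g q)) \<circ> inv_into U c)"
    by (simp add: o_def)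
qed

lemmas smooth_fun_on_mult = smooth_fun_on_bilinear[OF bounded_bilinear_mult]

lemma smooth_fun_on_add:
  assumes "open W" "smooth_fun_on A W f" "smooth_fun_on A W g"
  shows "smooth_fun_on A W (\<lambda>q. f q + g q)"
  unfolding smooth_fun_on_def
proof clarify
  fix U c assume C: "(U, c) \<in> A"
  have "smooth_on (c ` (U \<inter> W)) (\<lambda>x. (f \<circ> inv_into U c) x + (g \<circ> inv_into U c) x)"
    by (rule smooth_on_add[OF open_chart_image[OF C assms(1)]
          smooth_fun_onD[OF assms(2) C] smooth_fun_onD[OF assms(3) C]])
  then show "smooth_on (c ` (U \<inter> W)) ((\<lambda>q. f q + g q) \<circ> inv_into U c)"
    by (simp add: o_def)
qed

text \<open>One chart suffices because every other coordinate expression differs from this one by a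
  smooth transition map.\<close>

lemma smooth_fun_on_chart:
  assumes C: "(U, c) \<in> A" and W: "open W" "W \<subseteq> U"
    and f: "smooth_on (c ` W) (f \<circ> inv_into U c)"
  shows "smooth_fun_on A W f"
  unfolding smooth_fun_on_def
proof clarify
  fix V d assume D: "(V, d) \<in> A"
  have "smooth_on (d ` (V \<inter> W)) ((f \<circ> inv_into U c) \<circ> (c \<circ> inv_into V d))"
    by (rule smooth_on_compose[OF open_chart_image[OF D W(1)] _
          smooth_on_subset[OF smooth_transition[OF D C]] f]) (use D W(2) in auto)
  then show "smooth_on (d ` (V \<inter> W)) (f \<circ> inv_into V d)"
    by (rule smooth_on_cong[OF open_chart_image[OF D W(1)], rotated])
      (use C D W(2) in \<open>auto simp: subset_iff\<close>)
qed

lemma smooth_fun_on_coord: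
  assumes "(U, c) \<in> A"
  shows "smooth_fun_on A U (\<lambda>q. c q \<bullet> b)"
proof (rule smooth_fun_on_chart[OF assms open_chart[OF assms] order_refl])
  have "smooth_on (c ` U) (\<lambda>x. x \<bullet> b)"
    by (rule smooth_on_linear[OF bounded_linear_inner_left])
  then show "smooth_on (c ` U) ((\<lambda>q. c q \<bullet> b) \<circ> inv_into U c)"
    by (rule smooth_on_cong[OF open_chart_range[OF assms], rotated]) (use assms in auto)
qed

lemma smooth_near_add:
  "smooth_near A p f \<Longrightarrow> smooth_near A p g \<Longrightarrow> smooth_near A p (\<lambda>q. f q + g q)"
  unfolding smooth_near_def
  by (metis (no_types, lifting) IntI Int_lower1 Int_lower2 open_Int smooth_fun_on_add smooth_fun_on_subset)

lemma smooth_near_mult: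
  "smooth_near A p f \<Longrightarrow> smooth_near A p g \<Longrightarrow> smooth_near A p (\<lambda>q. f q * g q :: real)"
  unfolding smooth_near_def
  by (metis (no_types, lifting) IntI Int_lower1 Int_lower2 open_Int smooth_fun_on_mult smooth_fun_on_subset)

lemma smooth_near_const: "smooth_near A p (\<lambda>q. c)"
  by (rule smooth_nearI[OF smooth_fun_on_const open_UNIV UNIV_I])

lemma smooth_near_cong:
  assumes "smooth_near A p f" "open W" "p \<in> W" "\<And>q. q \<in> W \<Longrightarrow> f q = g q"
  shows "smooth_near A p g"
proof -
  obtain W' where "open W'" "p \<in> W'" "smooth_fun_on A W' f"
    using assms(1) unfolding smooth_near_def by blast
  then have "smooth_fun_on A (W \<inter> W') g"
    using assms by (intro smooth_fun_on_cong[of "W \<inter> W'" f g]) (auto intro: smooth_fun_on_subset)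
  then show ?thesis by (rule smooth_nearI) (use assms \<open>open W'\<close> \<open>p \<in> W'\<close> in auto)
qed

lemma smooth_near_differentiable:
  assumes "(U, c) \<in> A" "q \<in> U" "smooth_near A q f"
  shows "(f \<circ> inv_into U c) differentiable (at (c q))"
proof -
  obtain W where "q \<in> W" "smooth_on (c ` (U \<inter> W)) (f \<circ> inv_into U c)"
    using assms unfolding smooth_near_def smooth_fun_on_def by blast
  then show ?thesis using assms(2) by (auto intro: smooth_on_imp_differentiable)
qed

text \<open>By the chain rule a velocity depends on its curve only through the coordinate velocity.
  This is what makes the set of velocities at a point a vector space.\<close>

lemma velocity_eq_chart_vec:
  assumes C: "(U, c) \<in> A" and \<alpha>: "smooth_curve A \<alpha>" "\<alpha> 0 \<in> U"
  shows "velocity A \<alpha> = chart_vec A U c (vector_derivative (c \<circ> \<alpha>) (at 0)) (\<alpha> 0)"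
proof
  fix f :: "'a \<Rightarrow> real"
  let ?w = "vector_derivative (c \<circ> \<alpha>) (at 0)"
  let ?f' = "frechet_derivative (f \<circ> inv_into U c) (at (c (\<alpha> 0)))"
  obtain \<epsilon> where \<epsilon>: "\<epsilon> > 0" "continuous_on {-\<epsilon><..<\<epsilon>} \<alpha>"
    and sm: "smooth_on {t \<in> {-\<epsilon><..<\<epsilon>}. \<alpha> t \<in> U} (c \<circ> \<alpha>)"
    using \<alpha>(1) C unfolding smooth_curve_def by blast
  define S where "S = {-\<epsilon><..<\<epsilon>} \<inter> \<alpha> -` U"
  have S: "open S" "0 \<in> S"
    using continuous_open_preimage[OF \<epsilon>(2) _ open_chart[OF C]] \<alpha> \<epsilon> by (auto simp: S_def)
  have "(c \<circ> \<alpha>) differentiable (at 0)"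
    by (rule smooth_on_imp_differentiable[OF sm]) (use \<epsilon> \<alpha> in auto)
  then have w: "((c \<circ> \<alpha>) has_derivative (\<lambda>h. h *\<^sub>R ?w)) (at 0)"
    by (simp only: vector_derivative_works has_vector_derivative_def)
  show "velocity A \<alpha> f = chart_vec A U c ?w (\<alpha> 0) f"
  proof (cases "smooth_near A (\<alpha> 0) f")
    case True
    have diff: "(f \<circ> inv_into U c) differentiable (at (c (\<alpha> 0)))"
      by (rule smooth_near_differentiable[OF C \<alpha>(2) True])
    then have "((f \<circ> inv_into U c) has_derivative ?f') (at ((c \<circ> \<alpha>) 0))"
      by (simp add: frechet_derivative_works)
    from diff_chain_at[OF w this]
    have "((f \<circ> inv_into U c) \<circ> (c \<circ> \<alpha>) has_derivative (\<lambda>h. ?f' (h *\<^sub>R ?w))) (at 0)"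
      by (simp add: o_def)
    then have "(f \<circ> \<alpha> has_derivative (\<lambda>h. ?f' (h *\<^sub>R ?w))) (at 0)"
      by (rule has_derivative_transform_within_open[OF _ S]) (use C in \<open>auto simp: S_def\<close>)
    moreover have "?f' (h *\<^sub>R ?w) = ?f' ?w * h" for h
      using linear_cmul[OF linear_frechet_derivative[OF diff]] by simp
    ultimately have "(f \<circ> \<alpha> has_real_derivative ?f' ?w) (at 0)"
      by (simp add: has_field_derivative_def)
    then show ?thesis using True by (simp add: velocity_def chart_vec_def DERIV_imp_deriv)
  qed (simp add: velocity_def chart_vec_def)
qed

lemma chart_vec_tangent:
  assumes C: "(U, c) \<in> A" and q: "q \<in> U"
  shows "chart_vec A U c w q \<in> tangent_space A q"
proof -
  \<comment> \<open>The curve that realises \<open>w\<close> is the straight coordinate line through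
    \<open>c q\<close>, pulled back by the chart; \<epsilon> is taken so small that the line stays
    in the range of the chart.\<close>
  define l where "l = (\<lambda>t. c q + t *\<^sub>R w)"
  define \<alpha> where "\<alpha> = inv_into U c \<circ> l"
  have contl: "continuous_on T l" for T unfolding l_def by (intro continuous_intros)
  have "open (l -` (c ` U))"
    by (rule open_vimage[OF open_chart_range[OF C] contl])
  moreover have "0 \<in> l -` (c ` U)" using q by (auto simp: l_def)
  ultimately obtain \<epsilon> where \<epsilon>: "\<epsilon> > 0" "ball 0 \<epsilon> \<subseteq> l -` (c ` U)"
    using open_contains_ball by blast
  let ?I = "{-\<epsilon><..<\<epsilon>}"
  have lU: "l t \<in> c ` U" if "t \<in> ?I" for t
    using that \<epsilon>(2) by (auto simp: ball_eq_greaterThanLessThan)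
  have c\<alpha>: "c (\<alpha> t) = l t" "\<alpha> t \<in> U" if "t \<in> ?I" for t
    using lU[OF that] C by (auto simp: \<alpha>_def)
  have cont: "continuous_on ?I \<alpha>"
    unfolding \<alpha>_def using homeo_chart[OF C] lU
    by (intro continuous_on_compose contl)
      (auto simp: homeomorphism_def intro: continuous_on_subset)
  have sm: "smooth_on {t \<in> ?I. \<alpha> t \<in> V} (d \<circ> \<alpha>)" if D: "(V, d) \<in> A" for V d
  proof -
    have "{t \<in> ?I. \<alpha> t \<in> V} = ?I \<inter> \<alpha> -` V" by auto
    then have op: "open {t \<in> ?I. \<alpha> t \<in> V}"
      using continuous_open_preimage[OF cont _ open_chart[OF D]] by simp
    have "smooth_on {t \<in> ?I. \<alpha> t \<in> V} l"
      unfolding l_def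
      by (rule smooth_on_add[OF op smooth_on_const smooth_on_linear[OF bounded_linear_scaleR_left]])
    moreover have "l ` {t \<in> ?I. \<alpha> t \<in> V} \<subseteq> c ` (U \<inter> V)"
    proof clarify
      fix t assume "t \<in> ?I" "\<alpha> t \<in> V"
      then show "l t \<in> c ` (U \<inter> V)" using c\<alpha>[of t] by (metis IntI imageI)
    qed
    ultimately have "smooth_on {t \<in> ?I. \<alpha> t \<in> V} ((d \<circ> inv_into U c) \<circ> l)"
      using smooth_on_compose[OF op _ _ smooth_transition[OF C D]] by blast
    then show ?thesis by (simp add: \<alpha>_def o_assoc)
  qed
  have "smooth_curve A \<alpha>"
    unfolding smooth_curve_def using \<epsilon>(1) cont sm by blast
  moreover have "\<alpha> 0 = q" using C q by (simp add: \<alpha>_def l_def)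
  moreover have "vector_derivative (c \<circ> \<alpha>) (at 0) = w"
  proof (rule vector_derivative_at)
    have "(l has_vector_derivative w) (at 0)"
      unfolding l_def by (auto intro!: derivative_eq_intros)
    then show "((c \<circ> \<alpha>) has_vector_derivative w) (at 0)"
      by (rule has_vector_derivative_transform_within_open[of _ _ _ ?I])
        (use \<epsilon>(1) c\<alpha> in auto)
  qed
  ultimately show ?thesis
    using velocity_eq_chart_vec[OF C, of \<alpha>] q unfolding tangent_space_def by (metis (mono_tags, lifting) mem_Collect_eq)
qed

lemma tangent_space_chart:
  assumes "(U, c) \<in> A" "q \<in> U"
  shows "tangent_space A q = range (\<lambda>w. chart_vec A U c w q)"
proof
  show "tangent_space A q \<subseteq> range (\<lambda>w. chart_vec A U c w q)"
    unfolding tangent_space_def using velocity_eq_chart_vec[OF assms(1)] assms(2) by auto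
qed (use chart_vec_tangent[OF assms] in auto)

lemma linear_chart_vec:
  assumes "(U, c) \<in> A" "q \<in> U"
  shows "linear (\<lambda>w. chart_vec A U c w q)"
proof
  note lin = linear_frechet_derivative[OF smooth_near_differentiable[OF assms]]
  show "chart_vec A U c (v + w) q = chart_vec A U c v q + chart_vec A U c w q" for v w
    using linear_add[OF lin] by (auto simp: chart_vec_def fun_eq_iff)
  show "chart_vec A U c (r *\<^sub>R w) q = r *\<^sub>R chart_vec A U c w q" for r w
    using linear_cmul[OF lin] by (auto simp: chart_vec_def fun_eq_iff scaleR_fun_def)
qed

lemma inj_chart_vec:
  assumes "(U, c) \<in> A" "q \<in> U"
  shows "inj (\<lambda>w. chart_vec A U c w q)"
proof -
  \<comment> \<open>The coordinate functions are smooth near \<open>q\<close> and, as test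
    functions, read off the components of \<open>w\<close>.\<close>
  have eq: "chart_vec A U c w q (\<lambda>q. c q \<bullet> b) = w \<bullet> b" for w b
  proof -
    have "((\<lambda>x. x \<bullet> b) has_derivative (\<lambda>x. x \<bullet> b)) (at (c q))"
      by (rule bounded_linear_imp_has_derivative[OF bounded_linear_inner_left])
    then have "((\<lambda>q. c q \<bullet> b) \<circ> inv_into U c has_derivative (\<lambda>x. x \<bullet> b)) (at (c q))"
      by (rule has_derivative_transform_within_open[OF _ open_chart_range[OF assms(1)]])
        (use assms in auto)
    then have "frechet_derivative ((\<lambda>q. c q \<bullet> b) \<circ> inv_into U c) (at (c q)) = (\<lambda>x. x \<bullet> b)"
      by (rule frechet_derivative_at[symmetric])
    then show ?thesis
      using smooth_nearI[OF smooth_fun_on_coord[OF assms(1)] open_chart[OF assms(1)] assms(2)]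
      by (simp add: chart_vec_def)
  qed
  show ?thesis
    by (rule injI) (metis eq euclidean_eqI)
qed

lemma subspace_tangent: "subspace (tangent_space A q)"
  by (rule obtain_chart[of q])
    (metis linear_chart_vec linear_subspace_image subspace_UNIV tangent_space_chart)

text \<open>Serves to exclude a nonzero vector orthogonal to three orthogonal nonzero ones when the
  dimension is three.\<close>

lemma card_independent_tangent_le:
  assumes "independent B" "B \<subseteq> tangent_space A q"
  shows "finite B \<and> card B \<le> DIM('e)"
proof -
  obtain U c where C: "(U, c) \<in> A" "q \<in> U" by (rule obtain_chart)
  let ?v = "\<lambda>w. chart_vec A U c w q"
  have "tangent_space A q = span (?v ` Basis)"
    using linear_span_image[OF linear_chart_vec[OF C], of Basis] tangent_space_chart[OF C] by simp
  then have "finite B \<and> card B \<le> card (?v ` Basis)"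
    using independent_span_bound[OF finite_imageI[OF finite_Basis] assms(1)] assms(2) by metis
  then show ?thesis using card_image_le[of "Basis :: 'e set" ?v] by simp
qed

lemma obtain_independent_tangent:
  obtains B where "independent B" "B \<subseteq> tangent_space A q" "finite B" "card B = DIM('e)"
proof -
  obtain U c where C: "(U, c) \<in> A" "q \<in> U" by (rule obtain_chart)
  let ?v = "\<lambda>w. chart_vec A U c w q"
  have inj: "inj_on ?v (span Basis)" using inj_chart_vec[OF C] by simp
  show ?thesis
  proof
    show "independent (?v ` Basis)"
      by (rule linear_independent_injective_image[OF linear_chart_vec[OF C] independent_Basis])
        (use inj in simp)
    show "?v ` Basis \<subseteq> tangent_space A q" using tangent_space_chart[OF C] by auto
    show "card (?v ` Basis) = DIM('e)"
      using inj_chart_vec[OF C] by (simp add: card_image inj_on_subset)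
  qed simp
qed

section \<open>Tangent vectors as local derivations\<close>

context
  fixes p v
  assumes v: "v \<in> tangent_space A p"
begin

lemma tangent_not_smooth: "\<not> smooth_near A p f \<Longrightarrow> v f = 0"
  using v unfolding tangent_space_def velocity_def by auto

lemma tangent_add:
  assumes "smooth_near A p f" "smooth_near A p g"
  shows "v (\<lambda>q. f q + g q) = v f + v g"
proof -
  obtain U c where C: "(U, c) \<in> A" "p \<in> U" by (rule obtain_chart)
  obtain w where w: "v = chart_vec A U c w p" using v tangent_space_chart[OF C] by auto
  note D = smooth_near_differentiable[OF C, unfolded frechet_derivative_works]
  have "((\<lambda>q. f q + g q) \<circ> inv_into U c has_derivative (\<lambda>u.
      frechet_derivative (f \<circ> inv_into U c) (at (c p)) u +
      frechet_derivative (g \<circ> inv_into U c) (at (c p)) u)) (at (c p))"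
    using has_derivative_add[OF D D, OF assms] by (simp add: o_def)
  from frechet_derivative_at[OF this, symmetric] show ?thesis
    using assms smooth_near_add[OF assms] by (simp add: w chart_vec_def)
qed

lemma tangent_mult:
  assumes "smooth_near A p f" "smooth_near A p g"
  shows "v (\<lambda>q. f q * g q) = f p * v g + v f * g p"
proof -
  obtain U c where C: "(U, c) \<in> A" "p \<in> U" by (rule obtain_chart)
  obtain w where w: "v = chart_vec A U c w p" using v tangent_space_chart[OF C] by auto
  note D = smooth_near_differentiable[OF C, unfolded frechet_derivative_works]
  have "((\<lambda>q. f q * g q) \<circ> inv_into U c has_derivative (\<lambda>u.
      f p * frechet_derivative (g \<circ> inv_into U c) (at (c p)) u +
      frechet_derivative (f \<circ> inv_into U c) (at (c p)) u * g p)) (at (c p))"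
    using has_derivative_mult[OF D D, OF assms] C by (simp add: o_def)
  from frechet_derivative_at[OF this, symmetric] show ?thesis
    using assms smooth_near_mult[OF assms] by (simp add: w chart_vec_def)
qed

lemma tangent_const: "v (\<lambda>q. a) = 0"
proof -
  obtain U c where C: "(U, c) \<in> A" "p \<in> U" by (rule obtain_chart)
  obtain w where w: "v = chart_vec A U c w p" using v tangent_space_chart[OF C] by auto
  show ?thesis by (simp add: w chart_vec_def o_def frechet_derivative_const)
qed

text \<open>Locality of tangent vectors. If one of the functions is not smooth near
  \<open>p\<close>, neither is the other, and both values are the default 0.\<close>

lemma tangent_cong:
  assumes "open W" "p \<in> W" "\<And>q. q \<in> W \<Longrightarrow> f q = g q"
  shows "v f = v g"
proof (cases "smooth_near A p f")
  case True
  obtain U c where C: "(U, c) \<in> A" "p \<in> U" by (rule obtain_chart)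
  obtain w where w: "v = chart_vec A U c w p" using v tangent_space_chart[OF C] by auto
  have g: "smooth_near A p g" by (rule smooth_near_cong[OF True assms])
  have "frechet_derivative (f \<circ> inv_into U c) (at (c p)) = frechet_derivative (g \<circ> inv_into U c) (at (c p))"
    by (rule frechet_derivative_transform_within_open[OF smooth_near_differentiable[OF C True]
          open_chart_image[OF C(1) assms(1)]]) (use C assms in auto)
  then show ?thesis using True g by (simp add: w chart_vec_def)
next
  case False
  moreover have "\<not> smooth_near A p g"
    using False smooth_near_cong[OF _ assms(1,2), of g f] assms(3) by auto
  ultimately show ?thesis by (simp add: tangent_not_smooth)
qed

lemma tangent_cmult:
  assumes "smooth_near A p f"
  shows "v (\<lambda>q. a * f q) = a * v f"
  using tangent_mult[OF smooth_near_const assms, of a] by (simp add: tangent_const)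

lemma tangent_diff:
  assumes "smooth_near A p f" "smooth_near A p g"
  shows "v (\<lambda>q. f q - g q) = v f - v g"
  using tangent_add[OF assms(1) smooth_near_mult[OF smooth_near_const[of _ "-1"] assms(2)]]
    tangent_cmult[OF assms(2), of "-1"] by simp

end

text \<open>Curvature and the axioms of the structure are stated for global fields, so this is the
  passage from them to statements about single tangent vectors. A coordinate field is cut off by a
  bump function inside its chart.\<close>

lemma extend_tangent_vector:
  assumes v: "v \<in> tangent_space A p"
  obtains X where "X \<in> vfields A" "X p = v"
proof -
  obtain U c where C: "(U, c) \<in> A" "p \<in> U" by (rule obtain_chart)
  obtain w where w: "v = chart_vec A U c w p" using v tangent_space_chart[OF C] by auto
  obtain r where r: "r > 0" "cball (c p) r \<subseteq> c ` U"
    using open_contains_cball open_chart_range[OF C(1)] C(2) by (metis imageI)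
  obtain \<beta> :: "'e \<Rightarrow> real" where \<beta>: "smooth_on UNIV \<beta>" "\<beta> (c p) = 1"
    "\<And>x. x \<notin> cball (c p) r \<Longrightarrow> \<beta> x = 0"
    using smooth_bump[OF r(1)] by blast
  define K where "K = inv_into U c ` cball (c p) r"
  have "compact K"
    unfolding K_def using homeo_chart[OF C(1)] r(2)
    by (intro compact_continuous_image) (auto simp: homeomorphism_def intro: continuous_on_subset)
  \<comment> \<open>Here the Hausdorff property is used. The domain \<open>U\<close> and the
    complement of \<open>K\<close> are open and cover the manifold; \<open>X\<close> is smooth on
    the first by its formula and on the second because it is 0 there.\<close>
  then have K: "closed K" by (rule compact_imp_closed)
  define X where "X = (\<lambda>q. if q \<in> U then \<beta> (c q) *\<^sub>R chart_vec A U c w q else 0)"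
  have out: "X q = 0" if "q \<notin> K" for q
  proof (cases "q \<in> U")
    case True
    then have "c q \<notin> cball (c p) r" using that C(1) by (metis K_def chart_inv imageI)
    then show ?thesis using \<beta>(3) by (simp add: X_def)
  qed (simp add: X_def)
  have KU: "K \<subseteq> U" using r(2) C(1) by (auto simp: K_def)
  have "X q \<in> tangent_space A q" for q
    using chart_vec_tangent[OF C(1)] subspace_tangent[of q]
    by (auto simp: X_def subspace_scale subspace_0)
  moreover have "smooth_fun_on A W (\<lambda>q. X q f)" if W: "open W" and f: "smooth_fun_on A W f" for W f
  proof (rule smooth_fun_on_local[OF W])
    fix q assume q: "q \<in> W"
    show "\<exists>W'. open W' \<and> q \<in> W' \<and> smooth_fun_on A W' (\<lambda>q. X q f)"
    proof (cases "q \<in> U")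
      case True
      have op: "open (U \<inter> W)" using W open_chart[OF C(1)] by auto
      have "smooth_fun_on A (U \<inter> W) (\<lambda>q. X q f)"
      proof (rule smooth_fun_on_chart[OF C(1) op])
        have "smooth_on (c ` (U \<inter> W)) (\<lambda>x. \<beta> x * frechet_derivative (f \<circ> inv_into U c) (at x) w)"
          using f C(1) unfolding smooth_fun_on_def
          by (intro smooth_on_bilinear[OF bounded_bilinear_mult open_chart_image[OF C(1) W]]
              smooth_on_subset[OF \<beta>(1)] smooth_on_frechet_derivative) auto
        then show "smooth_on (c ` (U \<inter> W)) ((\<lambda>q. X q f) \<circ> inv_into U c)"
        proof (rule smooth_on_cong[OF open_chart_image[OF C(1) W], rotated], clarify)
          fix q assume "q \<in> U" "q \<in> W"
          then show "\<beta> (c q) * frechet_derivative (f \<circ> inv_into U c) (at (c q)) w =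
              ((\<lambda>q. X q f) \<circ> inv_into U c) (c q)"
            using smooth_nearI[OF f W, of q] C(1)
            by (simp add: X_def chart_vec_def scaleR_fun_def)
        qed
      qed simp
      then show ?thesis using op True q by blast
    next
      case False
      have op: "open (W - K)" using W K by auto
      have "smooth_fun_on A (W - K) (\<lambda>q. X q f)"
        by (rule smooth_fun_on_cong[OF op smooth_fun_on_const[of _ _ 0]]) (simp add: out)
      then show ?thesis using op False KU q by blast
    qed
  qed
  ultimately have "X \<in> vfields A" unfolding vfields_def by auto
  moreover have "X p = v" using C \<beta>(2) by (simp add: X_def w)
  ultimately show ?thesis by (rule that)
qed

end

section \<open>Traces and vector fields\<close>

lemma fmult_apply [simp]: "(f \<odot> X) p = f p *\<^sub>R X p"
  by (simp add: fmult_def)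

lemma linear_map_onD:
  assumes "linear_map_on V L"
  shows "u \<in> V \<Longrightarrow> v \<in> V \<Longrightarrow> L (u + v) = L u + L v" and "u \<in> V \<Longrightarrow> L (a *\<^sub>R u) = a *\<^sub>R L u"
  using assms unfolding linear_map_on_def by auto

lemma linear_map_on_sum:
  assumes "linear_map_on V L" "subspace V" "\<And>i. i \<in> I \<Longrightarrow> v i \<in> V"
  shows "L (\<Sum>i\<in>I. v i) = (\<Sum>i\<in>I. L (v i))"
proof -
  have 0: "L 0 = 0"
    using linear_map_onD(2)[OF assms(1) subspace_0[OF assms(2)], of 0] by simp
  show ?thesis
  proof (cases "finite I")
    case True
    then show ?thesis using assms(3)
      by (induction I rule: finite_induct)
        (simp_all add: 0 linear_map_onD(1)[OF assms(1)] subspace_sum[OF assms(2)])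
  qed (simp add: 0)
qed

text \<open>\<open>endo_trace\<close> is a definite description over all bases, so the sum on the
  right has to be the value in every basis \<open>B\<close>. Expanding the elements of
  \<open>B\<close> by means of \<open>e\<close> and exchanging the two sums achieves this;
  \<open>expand\<close> says that the numbers \<open>b v (e i)\<close> are coefficients of
  \<open>v\<close>.\<close>

lemma endo_trace_orthonormal:
  fixes e :: "'i \<Rightarrow> 'v::real_vector"
  assumes V: "subspace V" and I: "finite I" and e: "\<And>i. i \<in> I \<Longrightarrow> e i \<in> V"
    and b: "\<And>u. u \<in> V \<Longrightarrow> linear_map_on V (\<lambda>v. b v u)"
    and expand: "\<And>v. v \<in> V \<Longrightarrow> v = (\<Sum>i\<in>I. b v (e i) *\<^sub>R e i)"
    and L: "linear_map_on V L" "\<And>v. v \<in> V \<Longrightarrow> L v \<in> V"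
  shows "endo_trace V L = (\<Sum>i\<in>I. b (L (e i)) (e i))"
proof -
  have tr: "(\<Sum>x\<in>B. representation B (L x) x) = (\<Sum>i\<in>I. b (L (e i)) (e i))"
    if B: "independent B" "span B = V" for B
  proof -
    have BV: "x \<in> V" if "x \<in> B" for x using span_base[OF that] B by simp
    have "(\<Sum>i\<in>I. b v (e i) *\<^sub>R e i) \<in> span (e ` I)" for v
      by (intro span_sum span_scale span_base imageI)
    then have "V \<subseteq> span (e ` I)" using expand by (metis subsetI)
    then have fin: "finite B"
      using independent_span_bound[OF finite_imageI[OF I] B(1)] BV by blast
    have "(\<Sum>x\<in>B. representation B (L x) x)
        = (\<Sum>x\<in>B. \<Sum>i\<in>I. b x (e i) * representation B (L (e i)) x)"
    proof (rule sum.cong[OF refl])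
      fix x assume "x \<in> B"
      then have x: "x = (\<Sum>i\<in>I. b x (e i) *\<^sub>R e i)" using expand BV by blast
      have "L x = (\<Sum>i\<in>I. b x (e i) *\<^sub>R L (e i))"
        by (subst x) (simp add: linear_map_on_sum[OF L(1) V] linear_map_onD(2)[OF L(1)] e V subspace_scale)
      then have "representation B (L x) = (\<lambda>y. \<Sum>i\<in>I. representation B (b x (e i) *\<^sub>R L (e i)) y)"
        using representation_sum[OF B(1), of I "\<lambda>i. b x (e i) *\<^sub>R L (e i)"] B(2) L(2) e V
        by (simp add: subspace_scale)
      then show "representation B (L x) x = (\<Sum>i\<in>I. b x (e i) * representation B (L (e i)) x)"
        using B L(2) e by (simp add: representation_scale)
    qed
    \<comment> \<open>After the exchange the inner sum over \<open>B\<close> is the basis expansion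
      of \<open>L (e i)\<close>, paired with \<open>e i\<close>.\<close>
    also have "\<dots> = (\<Sum>i\<in>I. \<Sum>x\<in>B. b (representation B (L (e i)) x *\<^sub>R x) (e i))"
      by (subst sum.swap) (simp add: linear_map_onD(2)[OF b] e BV mult.commute)
    also have "\<dots> = (\<Sum>i\<in>I. b (\<Sum>x\<in>B. representation B (L (e i)) x *\<^sub>R x) (e i))"
      by (rule sum.cong[OF refl])
        (simp add: linear_map_on_sum[OF b V] e BV V subspace_scale)
    also have "\<dots> = (\<Sum>i\<in>I. b (L (e i)) (e i))"
      using B L(2) e fin by (simp add: sum_representation_eq)
    finally show ?thesis .
  qed
  \<comment> \<open>Some basis must exist, since otherwise the condition under \<open>THE\<close>
    would hold vacuously for every number.\<close>
  obtain B where "B \<subseteq> V" "independent B" "V \<subseteq> span B" by (rule basis_exists)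
  then have "independent B" "span B = V" using span_minimal[OF _ V] by auto
  with tr show ?thesis
    unfolding endo_trace_def by (intro the_equality) metis+
qed

text \<open>Function-linearity of an operator whose result is already evaluated at \<open>p\<close>:
  a factor leaves only its value at \<open>p\<close>. Constant factors are included, so real
  linearity follows.\<close>

definition tensorial_at ::
    "('a::topological_space, 'e::euclidean_space) atlas \<Rightarrow> 'a \<Rightarrow> ('a vfield \<Rightarrow> 'b::real_vector) \<Rightarrow> bool"
  where "tensorial_at A p T \<longleftrightarrow>
    (\<forall>X\<in>vfields A. \<forall>Y\<in>vfields A. T (X + Y) = T X + T Y) \<and>
    (\<forall>f. \<forall>X\<in>vfields A. smooth_fun A f \<longrightarrow> T (f \<odot> X) = f p *\<^sub>R T X)"

section \<open>Vector fields as a module over the smooth functions, and their Lie bracket\<close>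

context smooth_mfd
begin

lemma vfield_tangent: "X \<in> vfields A \<Longrightarrow> X p \<in> tangent_space A p"
  unfolding vfields_def by blast

lemma vfield_smooth_fun_on:
  "X \<in> vfields A \<Longrightarrow> open W \<Longrightarrow> smooth_fun_on A W f \<Longrightarrow> smooth_fun_on A W (\<lambda>p. X p f)"
  unfolding vfields_def by blast

lemma vfield_smooth_fun: "X \<in> vfields A \<Longrightarrow> smooth_fun A f \<Longrightarrow> smooth_fun A (\<lambda>p. X p f)"
  using vfield_smooth_fun_on open_UNIV by blast

lemma vfield_smooth_near: "X \<in> vfields A \<Longrightarrow> smooth_near A p f \<Longrightarrow> smooth_near A p (\<lambda>q. X q f)"
  unfolding smooth_near_def using vfield_smooth_fun_on by blast

lemma vfield_add: "X \<in> vfields A \<Longrightarrow> Y \<in> vfields A \<Longrightarrow> X + Y \<in> vfields A"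
  unfolding vfields_def by (auto simp: subspace_add[OF subspace_tangent] smooth_fun_on_add)

lemma vfield_fmult:
  assumes "smooth_fun A f" "X \<in> vfields A"
  shows "f \<odot> X \<in> vfields A"
proof -
  have "smooth_fun_on A W (\<lambda>p. (f \<odot> X) p h)" if "open W" "smooth_fun_on A W h" for W h
    using smooth_fun_on_mult[OF that(1) smooth_fun_on_subset[OF assms(1)] vfield_smooth_fun_on[OF assms(2) that]]
    by (simp add: scaleR_fun_def)
  then show ?thesis
    using vfield_tangent[OF assms(2)] unfolding vfields_def
    by (auto simp: subspace_scale[OF subspace_tangent])
qed

lemma const_fmult: "(\<lambda>q. a) \<odot> X = a *\<^sub>R X"
  by (simp add: fmult_def scaleR_fun_def)

lemma vfield_scaleR: "X \<in> vfields A \<Longrightarrow> a *\<^sub>R X \<in> vfields A"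
  using vfield_fmult[OF smooth_fun_on_const] const_fmult by metis

lemma vfield_uminus: "X \<in> vfields A \<Longrightarrow> - X \<in> vfields A"
  using vfield_scaleR[of X "-1"] by simp

lemma vfield_diff: "X \<in> vfields A \<Longrightarrow> Y \<in> vfields A \<Longrightarrow> X - Y \<in> vfields A"
  using vfield_add[OF _ vfield_uminus] by (metis diff_conv_add_uminus)

lemma lie_bracket_swap: "lie_bracket A X Y = - lie_bracket A Y X"
  by (simp add: lie_bracket_def fun_eq_iff)

lemma lie_bracket_self: "lie_bracket A X X = 0"
  by (simp add: lie_bracket_def fun_eq_iff)

lemma lie_bracket_apply:
  "smooth_near A p f \<Longrightarrow> lie_bracket A X Y p f = X p (\<lambda>q. Y q f) - Y p (\<lambda>q. X q f)"
  by (simp add: lie_bracket_def)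

lemma lie_bracket_add_right:
  assumes "X \<in> vfields A" "Y \<in> vfields A" "Z \<in> vfields A"
  shows "lie_bracket A X (Y + Z) = lie_bracket A X Y + lie_bracket A X Z"
proof (intro ext)
  fix p f
  show "lie_bracket A X (Y + Z) p f = (lie_bracket A X Y + lie_bracket A X Z) p f"
    using tangent_add[OF vfield_tangent[OF assms(1)]
        vfield_smooth_near[OF assms(2)] vfield_smooth_near[OF assms(3)], of p f f]
    by (simp add: lie_bracket_def)
qed

lemma lie_bracket_fmult_right:
  assumes X: "X \<in> vfields A" and Y: "Y \<in> vfields A" and f: "smooth_fun A f"
  shows "lie_bracket A X (f \<odot> Y) = f \<odot> lie_bracket A X Y + (\<lambda>p. X p f) \<odot> Y"
proof (intro ext)
  fix p h
  show "lie_bracket A X (f \<odot> Y) p h = (f \<odot> lie_bracket A X Y + (\<lambda>p. X p f) \<odot> Y) p h"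
  proof (cases "smooth_near A p h")
    case True
    show ?thesis
      using tangent_mult[OF vfield_tangent[OF X] smooth_fun_imp_smooth_near[OF f] vfield_smooth_near[OF Y True]]
      by (simp add: lie_bracket_apply True scaleR_fun_def algebra_simps)
  next
    \<comment> \<open>The bracket is 0 on such functions by convention, and the derivative term on
      the right vanishes because \<open>Y p\<close> is 0 on them too.\<close>
    case False
    then show ?thesis
      using tangent_not_smooth[OF vfield_tangent[OF Y] False]
      by (simp add: lie_bracket_def scaleR_fun_def)
  qed
qed

lemma jacobi:
  assumes "X \<in> vfields A" "Y \<in> vfields A" "Z \<in> vfields A"
  shows "lie_bracket A X (lie_bracket A Y Z) + lie_bracket A Y (lie_bracket A Z X)
    + lie_bracket A Z (lie_bracket A X Y) = 0"
proof (intro ext)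
  fix p h
  show "(lie_bracket A X (lie_bracket A Y Z) + lie_bracket A Y (lie_bracket A Z X)
    + lie_bracket A Z (lie_bracket A X Y)) p h = 0 p h"
  proof (cases "smooth_near A p h")
    case True
    have exp: "lie_bracket A X (lie_bracket A Y Z) p h =
        X p (\<lambda>q. Y q (\<lambda>q. Z q h)) - X p (\<lambda>q. Z q (\<lambda>q. Y q h))
        - (Y p (\<lambda>q. Z q (\<lambda>q. X q h)) - Z p (\<lambda>q. Y q (\<lambda>q. X q h)))"
      if X: "X \<in> vfields A" and Y: "Y \<in> vfields A" and Z: "Z \<in> vfields A" for X Y Z
    proof -
      note sm = vfield_smooth_near[OF X True] vfield_smooth_near[OF Y True] vfield_smooth_near[OF Z True]
      \<comment> \<open>\<open>X p\<close> differentiates the inner bracket, which therefore has to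
        be unfolded on a neighbourhood of \<open>p\<close> and not only at \<open>p\<close>.\<close>
      obtain W where W: "open W" "p \<in> W" "\<And>q. q \<in> W \<Longrightarrow> smooth_near A q h"
        using smooth_near_eventually[OF True] by blast
      have "X p (\<lambda>q. lie_bracket A Y Z q h) = X p (\<lambda>q. Y q (\<lambda>q. Z q h) - Z q (\<lambda>q. Y q h))"
        by (rule tangent_cong[OF vfield_tangent[OF X] W(1,2)]) (rule lie_bracket_apply[OF W(3)])
      also have "\<dots> = X p (\<lambda>q. Y q (\<lambda>q. Z q h)) - X p (\<lambda>q. Z q (\<lambda>q. Y q h))"
        by (rule tangent_diff[OF vfield_tangent[OF X] vfield_smooth_near[OF Y sm(3)]
              vfield_smooth_near[OF Z sm(2)]])
      finally show ?thesis
        by (simp add: lie_bracket_apply[OF True] lie_bracket_apply[OF sm(1)])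
    qed
    show ?thesis using assms by (simp add: exp)
  qed (simp add: lie_bracket_def)
qed

end

section \<open>Curvature of the Levi-Civita connection\<close>

locale riemannian_mfd = smooth_mfd A
  for A :: "('a::{t2_space, second_countable_topology}, 'e::euclidean_space) atlas" +
  fixes g :: "'a bilin_field" and D :: "'a connection"
  assumes metric: "riemannian_metric A g" and levi_civita: "levi_civita A g D"
begin

lemma metric_linear:
  assumes "u \<in> tangent_space A p"
  shows "linear_map_on (tangent_space A p) (g p u)"
    and "linear_map_on (tangent_space A p) (\<lambda>v. g p v u)"
  using metric assms subspace_tangent[of p]
  by (auto simp: riemannian_metric_def linear_map_on_def subspace_add subspace_scale)

lemma metric_sym: "u \<in> tangent_space A p \<Longrightarrow> v \<in> tangent_space A p \<Longrightarrow> g p u v = g p v u"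
  using metric unfolding riemannian_metric_def by blast

lemma metric_pos: "u \<in> tangent_space A p \<Longrightarrow> u \<noteq> 0 \<Longrightarrow> g p u u > 0"
  using metric unfolding riemannian_metric_def by blast

lemma metric_smooth: "X \<in> vfields A \<Longrightarrow> Y \<in> vfields A \<Longrightarrow> smooth_fun A (eval2 g X Y)"
  using metric unfolding riemannian_metric_def by blast

lemmas metric_add_left = linear_map_onD(1)[OF metric_linear(2)]
lemmas metric_add_right = linear_map_onD(1)[OF metric_linear(1)]
lemmas metric_scaleR_left = linear_map_onD(2)[OF metric_linear(2), simplified]
lemmas metric_scaleR_right = linear_map_onD(2)[OF metric_linear(1), simplified]

lemma metric_zero_left: "u \<in> tangent_space A p \<Longrightarrow> g p 0 u = 0"
  using metric_scaleR_left[of u p 0 0] subspace_0[OF subspace_tangent] by simp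

lemma metric_zero_right: "u \<in> tangent_space A p \<Longrightarrow> g p u 0 = 0"
  using metric_scaleR_right[of u p 0 0] subspace_0[OF subspace_tangent] by simp

lemma metric_minus_left: "u \<in> tangent_space A p \<Longrightarrow> v \<in> tangent_space A p \<Longrightarrow> g p (- u) v = - g p u v"
  using metric_scaleR_left[of v p u "-1"] by simp

lemma metric_minus_right: "u \<in> tangent_space A p \<Longrightarrow> v \<in> tangent_space A p \<Longrightarrow> g p u (- v) = - g p u v"
  using metric_scaleR_right[of u p v "-1"] by simp

lemma metric_diff_left:
  "u \<in> tangent_space A p \<Longrightarrow> v \<in> tangent_space A p \<Longrightarrow> w \<in> tangent_space A p \<Longrightarrow>
    g p (u - v) w = g p u w - g p v w"
  using metric_add_left[of w p u "- v"] metric_minus_left[of v p w] subspace_neg[OF subspace_tangent]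
  by simp

lemma metric_diff_right:
  "u \<in> tangent_space A p \<Longrightarrow> v \<in> tangent_space A p \<Longrightarrow> w \<in> tangent_space A p \<Longrightarrow>
    g p w (u - v) = g p w u - g p w v"
  using metric_add_right[of w p u "- v"] metric_minus_right[of w p v] subspace_neg[OF subspace_tangent]
  by simp

lemma orthogonal_imp_independent:
  assumes S: "S \<subseteq> tangent_space A p" "finite S" "0 \<notin> S"
    and orth: "\<And>u v. u \<in> S \<Longrightarrow> v \<in> S \<Longrightarrow> u \<noteq> v \<Longrightarrow> g p u v = 0"
  shows "independent S"
proof
  assume "dependent S"
  then obtain f x where eq: "(\<Sum>x\<in>S. f x *\<^sub>R x) = 0" and x: "x \<in> S" and f: "f x \<noteq> 0"
    unfolding dependent_finite[OF S(2)] by auto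
  then have xT: "x \<in> tangent_space A p" using S by auto
  have "0 = g p x (\<Sum>x\<in>S. f x *\<^sub>R x)" using eq metric_zero_right[OF xT] by simp
  also have "\<dots> = (\<Sum>y\<in>S. f y * g p x y)"
    using S(1) subspace_tangent xT
    by (subst linear_map_on_sum[OF metric_linear(1)[OF xT] subspace_tangent])
      (auto simp: subspace_scale metric_scaleR_right intro!: sum.cong)
  also have "\<dots> = (\<Sum>y\<in>S. if y = x then f x * g p x x else 0)"
    by (rule sum.cong) (use orth x in auto)
  also have "\<dots> = f x * g p x x" using S(2) x by simp
  finally have z: "f x * g p x x = 0" by (rule sym)
  have "x \<noteq> 0" by (rule notI) (use x S(3) in \<open>simp only:\<close>)
  then have "g p x x > 0" by (rule metric_pos[OF xT])
  then show False using z f by simp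
qed

lemmas affine_conn = levi_civita[unfolded levi_civita_def affine_connection_def, THEN conjunct1]

lemmas conn_vfield = affine_conn[THEN conjunct1, rule_format]

lemmas conn_add_left = affine_conn[THEN conjunct2, THEN conjunct1, rule_format, THEN conjunct1]
lemmas conn_add_right = affine_conn[THEN conjunct2, THEN conjunct1, rule_format, THEN conjunct2]

lemmas conn_fmult_left = affine_conn[THEN conjunct2, THEN conjunct2, rule_format, THEN conjunct1]
lemmas conn_fmult_right = affine_conn[THEN conjunct2, THEN conjunct2, rule_format, THEN conjunct2]

lemmas torsion_free =
  levi_civita[unfolded levi_civita_def, THEN conjunct2, THEN conjunct1, rule_format]

lemmas metric_compatible =
  levi_civita[unfolded levi_civita_def, THEN conjunct2, THEN conjunct2, rule_format]

text \<open>Torsion-freeness exhibits the bracket as a difference of two covariant derivatives, so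
  closure under brackets needs no coordinates.\<close>

lemma lie_bracket_vfield: "X \<in> vfields A \<Longrightarrow> Y \<in> vfields A \<Longrightarrow> lie_bracket A X Y \<in> vfields A"
  using torsion_free vfield_diff conn_vfield by metis

lemma conn_minus_left: "X \<in> vfields A \<Longrightarrow> Y \<in> vfields A \<Longrightarrow> D (- X) Y = - D X Y"
  using conn_fmult_left[OF _ _ smooth_fun_on_const, of X Y "- 1"] by (simp add: const_fmult)

lemma conn_diff_right:
  assumes "X \<in> vfields A" "Y \<in> vfields A" "Z \<in> vfields A"
  shows "D X (Y - Z) = D X Y - D X Z"
  using conn_add_right[OF assms(1) vfield_diff[OF assms(2,3)] assms(3)] by (simp add: algebra_simps)

lemma conn_diff_left:
  assumes "X \<in> vfields A" "Y \<in> vfields A" "Z \<in> vfields A"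
  shows "D (X - Y) Z = D X Z - D Y Z"
  using conn_add_left[OF vfield_diff[OF assms(1,2)] assms(2,3)] by (simp add: algebra_simps)

abbreviation R :: "'a vfield \<Rightarrow> 'a vfield \<Rightarrow> 'a vfield \<Rightarrow> 'a vfield"
  where "R \<equiv> curvature A D"

lemma curvature_vfield:
  "X \<in> vfields A \<Longrightarrow> Y \<in> vfields A \<Longrightarrow> Z \<in> vfields A \<Longrightarrow> R X Y Z \<in> vfields A"
  unfolding curvature_def by (intro vfield_diff conn_vfield lie_bracket_vfield)

lemma curvature_swap:
  assumes "X \<in> vfields A" "Y \<in> vfields A" "Z \<in> vfields A"
  shows "R X Y Z = - R Y X Z"
  using assms lie_bracket_swap[of X Y] lie_bracket_vfield
  by (simp add: curvature_def conn_minus_left)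

lemma curvature_add_left:
  assumes "X \<in> vfields A" "X' \<in> vfields A" "Y \<in> vfields A" "Z \<in> vfields A"
  shows "R (X + X') Y Z = R X Y Z + R X' Y Z"
proof -
  have "lie_bracket A (X + X') Y = lie_bracket A X Y + lie_bracket A X' Y"
    using lie_bracket_add_right[of Y X X'] assms
    by (subst (1 2 3) lie_bracket_swap) simp
  then show ?thesis using assms
    by (simp add: curvature_def conn_add_left conn_add_right conn_vfield lie_bracket_vfield)
qed

text \<open>The derivative of \<open>f\<close> along \<open>Y\<close> occurs twice, from the product
  rule for \<open>D Y\<close> and from the bracket of \<open>f \<odot> X\<close> with
  \<open>Y\<close>, and the two occurrences cancel.\<close>

lemma curvature_fmult_left:
  assumes X: "X \<in> vfields A" and Y: "Y \<in> vfields A" and Z: "Z \<in> vfields A" and f: "smooth_fun A f"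
  shows "R (f \<odot> X) Y Z = f \<odot> R X Y Z"
proof -
  have "lie_bracket A (f \<odot> X) Y = f \<odot> lie_bracket A X Y - (\<lambda>p. Y p f) \<odot> X"
    using lie_bracket_fmult_right[OF Y X f]
    by (subst (1 2) lie_bracket_swap) (simp add: fun_eq_iff scaleR_fun_def)
  then have "R (f \<odot> X) Y Z = f \<odot> D X (D Y Z) - (f \<odot> D Y (D X Z) + (\<lambda>p. Y p f) \<odot> D X Z)
      - (f \<odot> D (lie_bracket A X Y) Z - (\<lambda>p. Y p f) \<odot> D X Z)"
    using assms
    by (simp add: curvature_def conn_fmult_left conn_fmult_right conn_diff_left conn_vfield
        lie_bracket_vfield vfield_fmult vfield_smooth_fun)
  then show ?thesis by (simp add: curvature_def fun_eq_iff scaleR_fun_def algebra_simps)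
qed

lemma curvature_add_right:
  assumes "X \<in> vfields A" "Y \<in> vfields A" "Z \<in> vfields A" "Z' \<in> vfields A"
  shows "R X Y (Z + Z') = R X Y Z + R X Y Z'"
  using assms by (simp add: curvature_def conn_add_right conn_vfield lie_bracket_vfield)

text \<open>The terms with one derivative of \<open>f\<close> are symmetric in \<open>X\<close> and
  \<open>Y\<close> and drop out; those with two derivatives form the commutator of \<open>X\<close>
  and \<open>Y\<close> on \<open>f\<close>, which is the bracket term.\<close>

lemma curvature_fmult_right:
  assumes X: "X \<in> vfields A" and Y: "Y \<in> vfields A" and Z: "Z \<in> vfields A" and f: "smooth_fun A f"
  shows "R X Y (f \<odot> Z) = f \<odot> R X Y Z"
proof -
  have 2: "D X (D Y (f \<odot> Z)) = f \<odot> D X (D Y Z) + (\<lambda>p. X p f) \<odot> D Y Z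
      + ((\<lambda>p. Y p f) \<odot> D X Z + (\<lambda>p. X p (\<lambda>q. Y q f)) \<odot> Z)"
    if "X \<in> vfields A" "Y \<in> vfields A" for X Y
    using that Z f by (simp add: conn_fmult_right conn_add_right conn_vfield vfield_fmult vfield_smooth_fun)
  have br: "(\<lambda>p. lie_bracket A X Y p f) = (\<lambda>p. X p (\<lambda>q. Y q f) - Y p (\<lambda>q. X q f))"
    using smooth_fun_imp_smooth_near[OF f] by (simp add: lie_bracket_apply)
  have "D (lie_bracket A X Y) (f \<odot> Z) = f \<odot> D (lie_bracket A X Y) Z
      + (\<lambda>p. X p (\<lambda>q. Y q f) - Y p (\<lambda>q. X q f)) \<odot> Z"
    using conn_fmult_right[OF lie_bracket_vfield[OF X Y] Z f] br by simp
  then show ?thesis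
    by (simp add: curvature_def 2[OF X Y] 2[OF Y X] fun_eq_iff scaleR_fun_def algebra_simps)
qed

text \<open>Grouped by the outer derivative, the cyclic sum turns by torsion-freeness into the
  cyclic sum of double brackets, and the Jacobi identity applies.\<close>

lemma bianchi:
  assumes X: "X \<in> vfields A" and Y: "Y \<in> vfields A" and Z: "Z \<in> vfields A"
  shows "R X Y Z + R Y Z X + R Z X Y = 0"
proof -
  have *: "D X (D Y Z) - D X (D Z Y) - D (lie_bracket A Y Z) X = lie_bracket A X (lie_bracket A Y Z)"
    if X: "X \<in> vfields A" and Y: "Y \<in> vfields A" and Z: "Z \<in> vfields A" for X Y Z
    using conn_diff_right[OF X conn_vfield[OF Y Z] conn_vfield[OF Z Y]]
      torsion_free[OF Y Z] torsion_free[OF X lie_bracket_vfield[OF Y Z]] by simp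
  have "R X Y Z + R Y Z X + R Z X Y =
      (D X (D Y Z) - D X (D Z Y) - D (lie_bracket A Y Z) X)
    + (D Y (D Z X) - D Y (D X Z) - D (lie_bracket A Z X) Y)
    + (D Z (D X Y) - D Z (D Y X) - D (lie_bracket A X Y) Z)"
    by (simp add: curvature_def algebra_simps)
  then show ?thesis using jacobi[OF X Y Z] by (simp add: * X Y Z)
qed

text \<open>The bracket of \<open>X\<close> and \<open>Y\<close> is applied to the function g(Z,W)
  in two ways: as a commutator of derivatives and by metric compatibility. The mixed terms g(D_X Z,
  D_Y W) are cancelled by symmetry.\<close>

lemma curvature_metric_skew:
  assumes X: "X \<in> vfields A" and Y: "Y \<in> vfields A" and Z: "Z \<in> vfields A" and W: "W \<in> vfields A"
  shows "g p (R X Y Z p) (W p) = - g p (R X Y W p) (Z p)"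
proof -
  have 2: "X p (\<lambda>q. Y q (eval2 g Z W)) = g p (D X (D Y Z) p) (W p) + g p (D Y Z p) (D X W p)
      + (g p (D X Z p) (D Y W p) + g p (Z p) (D X (D Y W) p))"
    if X: "X \<in> vfields A" and Y: "Y \<in> vfields A" for X Y
  proof -
    have "X p (\<lambda>q. Y q (eval2 g Z W)) = X p (\<lambda>q. g q (D Y Z q) (W q) + g q (Z q) (D Y W q))"
      using metric_compatible[OF Y Z W] by simp
    also have "\<dots> = X p (eval2 g (D Y Z) W) + X p (eval2 g Z (D Y W))"
      by (intro tangent_add[OF vfield_tangent[OF X]] smooth_fun_imp_smooth_near metric_smooth Y Z W conn_vfield)
    finally show ?thesis using X Y Z W by (simp add: metric_compatible conn_vfield)
  qed
  have "lie_bracket A X Y p (eval2 g Z W) =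
      X p (\<lambda>q. Y q (eval2 g Z W)) - Y p (\<lambda>q. X q (eval2 g Z W))"
    by (intro lie_bracket_apply smooth_fun_imp_smooth_near metric_smooth Z W)
  moreover have "lie_bracket A X Y p (eval2 g Z W) =
      g p (D (lie_bracket A X Y) Z p) (W p) + g p (Z p) (D (lie_bracket A X Y) W p)"
    by (intro metric_compatible lie_bracket_vfield X Y Z W)
  moreover have "g p (Z p) (R X Y W p) = g p (R X Y W p) (Z p)"
    by (intro metric_sym vfield_tangent curvature_vfield X Y Z W)
  moreover have "g p (R X Y Z p) (W p) = g p (D X (D Y Z) p) (W p) - g p (D Y (D X Z) p) (W p)
      - g p (D (lie_bracket A X Y) Z p) (W p)"
    unfolding curvature_def using X Y Z W
    by (simp add: metric_diff_left vfield_tangent conn_vfield lie_bracket_vfield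
        subspace_diff[OF subspace_tangent])
  moreover have "g p (Z p) (R X Y W p) = g p (Z p) (D X (D Y W) p) - g p (Z p) (D Y (D X W) p)
      - g p (Z p) (D (lie_bracket A X Y) W p)"
    unfolding curvature_def using X Y Z W
    by (simp add: metric_diff_right vfield_tangent conn_vfield lie_bracket_vfield
        subspace_diff[OF subspace_tangent])
  ultimately show ?thesis by (simp add: 2[OF X Y] 2[OF Y X])
qed

lemma curvature_swap_metric:
  assumes "X \<in> vfields A" "Y \<in> vfields A" "Z \<in> vfields A" "W \<in> vfields A"
  shows "g p (R X Y Z p) (W p) = - g p (R Y X Z p) (W p)"
  using assms by (subst curvature_swap) (simp_all add: metric_minus_left vfield_tangent curvature_vfield)

text \<open>The classical octahedron argument: the four cyclic identities on X, Y, Z, W are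
  combined, and the two skew symmetries cancel all terms but the two wanted ones. What remains is
  linear arithmetic.\<close>

lemma curvature_pair_sym:
  assumes X: "X \<in> vfields A" and Y: "Y \<in> vfields A" and Z: "Z \<in> vfields A" and W: "W \<in> vfields A"
  shows "g p (R X Y Z p) (W p) = g p (R Z W X p) (Y p)"
proof -
  have b: "g p (R X Y Z p) (W p) + g p (R Y Z X p) (W p) + g p (R Z X Y p) (W p) = 0"
    if "X \<in> vfields A" "Y \<in> vfields A" "Z \<in> vfields A" "W \<in> vfields A" for X Y Z W
  proof -
    have "R X Y Z p + R Y Z X p + R Z X Y p = 0" using fun_cong[OF bianchi[OF that(1-3)], of p] by simp
    then show ?thesis using that metric_zero_left[OF vfield_tangent[OF that(4)], of p]
      by (simp add: metric_add_left[symmetric] vfield_tangent curvature_vfield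
          subspace_add[OF subspace_tangent])
  qed
  note s = curvature_swap_metric[where p = p] and m = curvature_metric_skew[where p = p]
  show ?thesis
    using b[OF X Y Z W] b[OF Y Z W X] b[OF Z W X Y] b[OF W X Y Z]
      m[OF X Y Z W] m[OF Y Z W X] m[OF Z W X Y] m[OF W X Y Z] m[OF X Z Y W] m[OF Y W Z X]
      m[OF Z X Y W] m[OF W Y Z X]  m[OF Y Z X W] m[OF Z W Y X] m[OF W X Z Y] m[OF X Y W Z]
      s[OF X Y Z W] s[OF Y Z X W] s[OF Z X Y W] s[OF Y Z W X] s[OF Z W Y X] s[OF W Y Z X]
      s[OF Z W X Y] s[OF W X Z Y] s[OF X Z W Y] s[OF W X Y Z] s[OF X Y W Z] s[OF Y W X Z]
      m[OF Y W X Z] m[OF X Z W Y]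
    by linarith
qed

lemma tensorial_curvature:
  assumes "Y \<in> vfields A" "Z \<in> vfields A"
  shows "tensorial_at A p (\<lambda>X. R X Y Z p)" "tensorial_at A p (\<lambda>X. R Y X Z p)"
    "tensorial_at A p (\<lambda>X. R Y Z X p)"
proof -
  show 1: "tensorial_at A p (\<lambda>X. R X Y Z p)"
    using assms by (simp add: tensorial_at_def curvature_add_left curvature_fmult_left)
  show "tensorial_at A p (\<lambda>X. R Y X Z p)"
    unfolding tensorial_at_def using assms
    by (simp add: curvature_swap[of Y] vfield_add vfield_fmult curvature_add_left curvature_fmult_left)
  show "tensorial_at A p (\<lambda>X. R Y Z X p)"
    using assms by (simp add: tensorial_at_def curvature_add_right curvature_fmult_right)
qed

end

section \<open>Ricci operator and scalar curvature in a frame\<close>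

text \<open>
  \<open>expand\<close> is what replaces the usual local-frame argument: function-linear operators are
  determined at \<open>p\<close> by their values on the frame.
\<close>

locale tensor_frame = riemannian_mfd A g D
  for A :: "('a::{t2_space, second_countable_topology}, 'e::euclidean_space) atlas"
    and g :: "'a bilin_field" and D :: "'a connection" +
  fixes p :: 'a and n :: nat and E :: "nat \<Rightarrow> 'a vfield"
  assumes frame: "\<And>i. E i \<in> vfields A"
    and orthonormal: "\<And>i j. i < n \<Longrightarrow> j < n \<Longrightarrow> g p (E i p) (E j p) = (if i = j then 1 else 0)"
    and expand: "\<And>T :: 'a vfield \<Rightarrow> 'a tvec. \<And>X. tensorial_at A p T \<Longrightarrow> X \<in> vfields A \<Longrightarrow>
      T X = (\<Sum>i<n. g p (X p) (E i p) *\<^sub>R T (E i))"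
begin

text \<open>Evaluation at \<open>p\<close> is itself a tensorial operator, so \<open>expand\<close>
  applies to it.\<close>

lemma expand_tangent:
  assumes "v \<in> tangent_space A p"
  shows "v = (\<Sum>i<n. g p v (E i p) *\<^sub>R E i p)"
proof -
  obtain X where "X \<in> vfields A" "X p = v" using extend_tangent_vector[OF assms] by blast
  then show ?thesis using expand[of "\<lambda>X. X p" X] by (simp add: tensorial_at_def)
qed

lemma metric_expand_left:
  assumes "\<And>i. i < n \<Longrightarrow> u i \<in> tangent_space A p" "v \<in> tangent_space A p"
  shows "g p (\<Sum>i<n. a i *\<^sub>R u i) v = (\<Sum>i<n. a i * g p (u i) v)"
  using assms subspace_tangent
  by (subst linear_map_on_sum[OF metric_linear(2)[OF assms(2)] subspace_tangent])
    (auto simp: subspace_scale metric_scaleR_left)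

text \<open>\<open>trace_op\<close> applies \<open>T\<close> to an extension picked by
  \<open>SOME\<close>; the first assumption makes the result at \<open>p\<close> the same for every
  extension. It asks for an expansion at \<open>p\<close>, the form in which the Ricci operator
  provides it.\<close>

lemma trace_op_frame:
  assumes T: "\<And>X. X \<in> vfields A \<Longrightarrow> T X p = (\<Sum>i<n. g p (X p) (E i p) *\<^sub>R T (E i) p)"
    "\<And>i. i < n \<Longrightarrow> T (E i) p \<in> tangent_space A p"
  shows "trace_op A T p = (\<Sum>i<n. g p (T (E i) p) (E i p))"
proof -
  define L where "L = (\<lambda>v. T (SOME V. V \<in> vfields A \<and> V p = v) p)"
  have L: "L v = (\<Sum>i<n. g p v (E i p) *\<^sub>R T (E i) p)" if "v \<in> tangent_space A p" for v
  proof -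
    define V where "V = (SOME V. V \<in> vfields A \<and> V p = v)"
    have "\<exists>V. V \<in> vfields A \<and> V p = v" using extend_tangent_vector[OF that] by blast
    from someI_ex[OF this] have V: "V \<in> vfields A" "V p = v" unfolding V_def by auto
    have "L v = T V p" by (simp only: L_def V_def)
    also have "\<dots> = (\<Sum>i<n. g p v (E i p) *\<^sub>R T (E i) p)" using T(1)[OF V(1)] unfolding V(2) .
    finally show ?thesis .
  qed
  have E: "E i p \<in> tangent_space A p" for i by (rule vfield_tangent[OF frame])
  have "endo_trace (tangent_space A p) L = (\<Sum>i<n. g p (L (E i p)) (E i p))"
  proof (rule endo_trace_orthonormal[OF subspace_tangent finite_lessThan E])
    show "linear_map_on (tangent_space A p) (\<lambda>v. g p v u)" if "u \<in> tangent_space A p" for u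
      by (rule metric_linear(2)[OF that])
    show "v = (\<Sum>i<n. g p v (E i p) *\<^sub>R E i p)" if "v \<in> tangent_space A p" for v
      by (rule expand_tangent[OF that])
    show "linear_map_on (tangent_space A p) L"
      unfolding linear_map_on_def
      by (auto simp: L subspace_add[OF subspace_tangent] subspace_scale[OF subspace_tangent] E
          metric_add_left metric_scaleR_left scaleR_add_left sum.distrib scaleR_right.sum)
    show "L v \<in> tangent_space A p" if "v \<in> tangent_space A p" for v
      unfolding L[OF that]
      by (intro subspace_sum[OF subspace_tangent] subspace_scale[OF subspace_tangent] T(2)) auto
  qed
  also have "\<dots> = (\<Sum>i<n. g p (T (E i) p) (E i p))"
    by (simp only: trans[OF L[OF E] T(1)[OF frame, symmetric]])
  finally show ?thesis by (simp add: trace_op_def L_def)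
qed

text \<open>The trace defining the Ricci form depends on \<open>Z\<close> only through its frame
  components, so the vector with components \<open>ric (E j)\<close> represents it; pairing a
  competitor with the frame shows uniqueness.\<close>

lemma ricci_operator_frame:
  assumes Y: "Y \<in> vfields A"
  shows "ricci_operator A g D Y p = (\<Sum>j<n. (\<Sum>i<n. g p (R (E i) Y (E j) p) (E i p)) *\<^sub>R E j p)"
proof -
  define ric where "ric Z = (\<Sum>i<n. g p (R (E i) Y Z p) (E i p))" for Z
  have E: "E i p \<in> tangent_space A p" for i by (rule vfield_tangent[OF frame])
  have ric: "trace_op A (\<lambda>X. R X Y Z) p = ric Z" if Z: "Z \<in> vfields A" for Z
    unfolding ric_def
    by (rule trace_op_frame)
      (intro expand tensorial_curvature Y Z, auto intro: vfield_tangent curvature_vfield Y Z frame)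
  have lin: "ric Z = (\<Sum>j<n. g p (Z p) (E j p) * ric (E j))" if Z: "Z \<in> vfields A" for Z
  proof -
    have "g p (R (E i) Y Z p) (E i p) = (\<Sum>j<n. g p (Z p) (E j p) * g p (R (E i) Y (E j) p) (E i p))" for i
      by (subst expand[OF tensorial_curvature(3)[OF frame Y] Z])
        (intro metric_expand_left E vfield_tangent curvature_vfield frame Y)
    then have "ric Z = (\<Sum>i<n. \<Sum>j<n. g p (Z p) (E j p) * g p (R (E i) Y (E j) p) (E i p))"
      by (simp add: ric_def)
    then show ?thesis by (subst (asm) sum.swap) (simp add: ric_def sum_distrib_left)
  qed
  have "ricci_operator A g D Y p = (\<Sum>j<n. ric (E j) *\<^sub>R E j p)"
    unfolding ricci_operator_def
  proof (rule the_equality, safe)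
    show "(\<Sum>j<n. ric (E j) *\<^sub>R E j p) \<in> tangent_space A p"
      by (intro subspace_sum[OF subspace_tangent] subspace_scale[OF subspace_tangent] E)
    show "g p (\<Sum>j<n. ric (E j) *\<^sub>R E j p) (Z p) = trace_op A (\<lambda>X. R X Y Z) p"
      if Z: "Z \<in> vfields A" for Z
    proof -
      have "g p (\<Sum>j<n. ric (E j) *\<^sub>R E j p) (Z p) = (\<Sum>j<n. ric (E j) * g p (E j p) (Z p))"
        by (intro metric_expand_left E vfield_tangent[OF Z])
      also have "\<dots> = ric Z"
        unfolding lin[OF Z] using metric_sym[OF E vfield_tangent[OF Z]] by (simp add: mult.commute)
      finally show ?thesis by (simp add: ric[OF Z])
    qed
    fix w assume w: "w \<in> tangent_space A p"
      "\<forall>Z\<in>vfields A. g p w (Z p) = trace_op A (\<lambda>X. R X Y Z) p"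
    have "g p w (E j p) = ric (E j)" for j using w(2) frame ric by simp
    then show "w = (\<Sum>j<n. ric (E j) *\<^sub>R E j p)" using expand_tangent[OF w(1)] by simp
  qed
  then show ?thesis by (simp add: ric_def)
qed

text \<open>The Ricci operator inherits its expansion in the frame from the second argument of the
  curvature; its trace then picks out the diagonal.\<close>

lemma scalar_curvature_frame:
  "scalar_curvature A g D p = (\<Sum>i<n. \<Sum>j<n. g p (R (E j) (E i) (E i) p) (E j p))"
proof -
  have E: "E i p \<in> tangent_space A p" for i by (rule vfield_tangent[OF frame])
  have "trace_op A (ricci_operator A g D) p = (\<Sum>i<n. g p (ricci_operator A g D (E i) p) (E i p))"
  proof (rule trace_op_frame)
    show "ricci_operator A g D (E i) p \<in> tangent_space A p" for i
      unfolding ricci_operator_frame[OF frame]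
      by (intro subspace_sum[OF subspace_tangent] subspace_scale[OF subspace_tangent] E)
    fix X assume X: "X \<in> vfields A"
    have "g p (R (E i) X (E j) p) (E i p) = (\<Sum>k<n. g p (X p) (E k p) * g p (R (E i) (E k) (E j) p) (E i p))" for i j
      by (subst expand[OF tensorial_curvature(2)[OF frame frame] X])
        (intro metric_expand_left E vfield_tangent curvature_vfield frame)
    then have "(\<Sum>i<n. g p (R (E i) X (E j) p) (E i p)) =
        (\<Sum>k<n. g p (X p) (E k p) * (\<Sum>i<n. g p (R (E i) (E k) (E j) p) (E i p)))" for j
      by (simp only: sum_distrib_left) (rule sum.swap)
    then have "ricci_operator A g D X p =
        (\<Sum>j<n. (\<Sum>k<n. g p (X p) (E k p) * (\<Sum>i<n. g p (R (E i) (E k) (E j) p) (E i p))) *\<^sub>R E j p)"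
      by (simp only: ricci_operator_frame[OF X])
    also have "\<dots> = (\<Sum>j<n. \<Sum>k<n. g p (X p) (E k p) *\<^sub>R
        ((\<Sum>i<n. g p (R (E i) (E k) (E j) p) (E i p)) *\<^sub>R E j p))"
      unfolding scaleR_scaleR by (subst scaleR_left.sum) (rule refl)
    also have "\<dots> = (\<Sum>k<n. g p (X p) (E k p) *\<^sub>R ricci_operator A g D (E k) p)"
      by (subst sum.swap) (simp add: ricci_operator_frame[OF frame] scaleR_right.sum)
    finally show "ricci_operator A g D X p = (\<Sum>k<n. g p (X p) (E k p) *\<^sub>R ricci_operator A g D (E k) p)" .
  qed
  also have "\<dots> = (\<Sum>i<n. \<Sum>j<n. g p (R (E j) (E i) (E i) p) (E j p))"
  proof (rule sum.cong[OF refl])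
    fix i assume i: "i \<in> {..<n}"
    have "g p (ricci_operator A g D (E i) p) (E i p) =
        (\<Sum>j<n. (\<Sum>k<n. g p (R (E k) (E i) (E j) p) (E k p)) * g p (E j p) (E i p))"
      unfolding ricci_operator_frame[OF frame] by (intro metric_expand_left E)
    also have "\<dots> = (\<Sum>j<n. if j = i then (\<Sum>k<n. g p (R (E k) (E i) (E i) p) (E k p)) else 0)"
      by (rule sum.cong) (use i orthonormal in auto)
    finally show "g p (ricci_operator A g D (E i) p) (E i p) = (\<Sum>j<n. g p (R (E j) (E i) (E i) p) (E j p))"
      using i by simp
  qed
  finally show ?thesis by (simp add: scalar_curvature_def)
qed

end

section \<open>Contact metric manifolds\<close>

lemma scaleR_fun_apply: "(a *\<^sub>R f) x = a *\<^sub>R f x"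
  by (simp add: scaleR_fun_def)

locale contact_metric_mfd = riemannian_mfd A g D
  for A :: "('a::{t2_space, second_countable_topology}, 'e::euclidean_space) atlas"
    and g :: "'a bilin_field" and D :: "'a connection" +
  fixes \<phi> :: "'a endo_field" and \<xi> :: "'a vfield" and \<eta> :: "'a form_field"
  assumes contact_metric: "contact_metric A \<phi> \<xi> \<eta> g"
begin

lemma almost_contact: "almost_contact_metric A \<phi> \<xi> \<eta> g"
  using contact_metric by (simp add: contact_metric_def)

lemma
  shows xi_vfield: "\<xi> \<in> vfields A"
    and phi_tensor: "tensor11 A \<phi>"
    and eta_form: "one_form A \<eta>"
    and eta_xi [simp]: "\<eta> p (\<xi> p) = 1"
  using almost_contact by (simp_all add: almost_contact_metric_def)

lemma phi_vfield: "X \<in> vfields A \<Longrightarrow> appl \<phi> X \<in> vfields A"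
  using phi_tensor by (simp add: tensor11_def)

lemma phi_linear: "linear_map_on (tangent_space A p) (\<phi> p)"
  using phi_tensor by (simp add: tensor11_def)

lemma phi_tangent: "v \<in> tangent_space A p \<Longrightarrow> \<phi> p v \<in> tangent_space A p"
  using phi_tensor by (auto simp: tensor11_def)

lemma eta_linear: "linear_map_on (tangent_space A p) (\<eta> p)"
  using eta_form by (simp add: one_form_def)

lemma eta_smooth: "X \<in> vfields A \<Longrightarrow> smooth_fun A (eval1 \<eta> X)"
  using eta_form by (simp add: one_form_def)

lemma xi_tangent: "\<xi> p \<in> tangent_space A p"
  by (rule vfield_tangent[OF xi_vfield])

lemmas phi_add = linear_map_onD(1)[OF phi_linear]
lemmas phi_scaleR = linear_map_onD(2)[OF phi_linear]
lemmas eta_add = linear_map_onD(1)[OF eta_linear]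
lemmas eta_scaleR = linear_map_onD(2)[OF eta_linear, simplified]

lemma phi_zero: "\<phi> p 0 = 0"
  using phi_scaleR[OF xi_tangent[of p], of 0] by simp

lemma phi_minus: "v \<in> tangent_space A p \<Longrightarrow> \<phi> p (- v) = - \<phi> p v"
  using phi_scaleR[of v p "-1"] by simp

lemma phi_diff:
  assumes "u \<in> tangent_space A p" "v \<in> tangent_space A p"
  shows "\<phi> p (u - v) = \<phi> p u - \<phi> p v"
  using phi_add[OF assms(1) subspace_neg[OF subspace_tangent assms(2)]] phi_minus[OF assms(2)] by simp

lemma eta_zero: "\<eta> p 0 = 0"
  using eta_scaleR[OF xi_tangent[of p], of 0] by simp

lemma eta_minus: "v \<in> tangent_space A p \<Longrightarrow> \<eta> p (- v) = - \<eta> p v"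
  using eta_scaleR[of v p "-1"] by simp

lemma eta_diff:
  assumes "u \<in> tangent_space A p" "v \<in> tangent_space A p"
  shows "\<eta> p (u - v) = \<eta> p u - \<eta> p v"
  using eta_add[OF assms(1) subspace_neg[OF subspace_tangent assms(2)]] eta_minus[OF assms(2)] by simp

text \<open>The axiom concerns fields; extending \<open>v\<close> brings it to a single tangent
  vector.\<close>

lemma phi_phi:
  assumes "v \<in> tangent_space A p"
  shows "\<phi> p (\<phi> p v) = - v + \<eta> p v *\<^sub>R \<xi> p"
proof -
  obtain X where X: "X \<in> vfields A" "X p = v" using extend_tangent_vector[OF assms] by blast
  have "appl \<phi> (appl \<phi> X) = - X + eval1 \<eta> X \<odot> \<xi>"
    using almost_contact X(1) by (simp add: almost_contact_metric_def)
  from fun_cong[OF this, of p] show ?thesis by (simp add: X(2))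
qed

lemma metric_phi_phi:
  assumes "u \<in> tangent_space A p" "v \<in> tangent_space A p"
  shows "g p (\<phi> p u) (\<phi> p v) = g p u v - \<eta> p u * \<eta> p v"
proof -
  obtain X where X: "X \<in> vfields A" "X p = u" using extend_tangent_vector[OF assms(1)] by blast
  obtain Y where Y: "Y \<in> vfields A" "Y p = v" using extend_tangent_vector[OF assms(2)] by blast
  have "g p (\<phi> p (X p)) (\<phi> p (Y p)) = g p (X p) (Y p) - \<eta> p (X p) * \<eta> p (Y p)"
    using almost_contact X(1) Y(1) unfolding almost_contact_metric_def by meson
  then show ?thesis by (simp add: X Y)
qed

lemma xi_nonzero: "\<xi> p \<noteq> 0"
  using eta_xi[of p] eta_zero[of p] zero_neq_one by metis

text \<open>From \<phi>\<phi>\<xi> = 0, a third application of \<phi> gives \<phi>\<xi> = c \<xi>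
  with c = \<eta>(\<phi>\<xi>). Then c \<phi>\<xi> = \<phi>\<phi>\<xi> = 0, and either factor being
  0 yields the claim.\<close>

lemma phi_xi: "\<phi> p (\<xi> p) = 0"
proof -
  have 2: "\<phi> p (\<phi> p (\<xi> p)) = 0" using phi_phi[OF xi_tangent] by simp
  have "- \<phi> p (\<xi> p) + \<eta> p (\<phi> p (\<xi> p)) *\<^sub>R \<xi> p = 0"
    using phi_phi[OF phi_tangent[OF xi_tangent[of p]], symmetric] unfolding 2 phi_zero .
  then have 1: "\<phi> p (\<xi> p) = \<eta> p (\<phi> p (\<xi> p)) *\<^sub>R \<xi> p"
    using minus_unique minus_minus by metis
  then have "\<eta> p (\<phi> p (\<xi> p)) *\<^sub>R \<phi> p (\<xi> p) = 0"
    using 2 phi_scaleR[OF xi_tangent] by metis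
  then show ?thesis using 1 by (metis scaleR_eq_0_iff)
qed

text \<open>The triple application of \<phi> to \<open>v\<close> is computed with the square taken
  last and with the square taken first; the results differ by \<eta>(\<phi>v) \<xi>.\<close>

lemma eta_phi: "v \<in> tangent_space A p \<Longrightarrow> \<eta> p (\<phi> p v) = 0"
proof -
  assume v: "v \<in> tangent_space A p"
  have "- \<phi> p v + \<eta> p (\<phi> p v) *\<^sub>R \<xi> p = \<phi> p (- v + \<eta> p v *\<^sub>R \<xi> p)"
    using phi_phi[OF phi_tangent[OF v]] phi_phi[OF v] by simp
  also have "\<dots> = - \<phi> p v"
    using v subspace_tangent[of p]
    by (simp add: phi_diff phi_minus phi_scaleR phi_xi xi_tangent subspace_scale)
  finally show ?thesis using xi_nonzero[of p] by simp
qed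

lemma metric_xi: "v \<in> tangent_space A p \<Longrightarrow> g p v (\<xi> p) = \<eta> p v"
  using metric_phi_phi[OF _ xi_tangent, of v p] phi_xi[of p] metric_zero_right[OF phi_tangent, of v p] by simp

lemma metric_xi_left: "v \<in> tangent_space A p \<Longrightarrow> g p (\<xi> p) v = \<eta> p v"
  using metric_xi metric_sym xi_tangent by metis

text \<open>This is L_\<xi> \<eta> = 0. The contact condition enters here: d\<eta>(\<xi>,X) =
  g(\<xi>,\<phi>X) = 0, while \<eta>(\<xi>) is constant.\<close>

lemma xi_eta:
  assumes "X \<in> vfields A"
  shows "\<xi> p (eval1 \<eta> X) = \<eta> p (lie_bracket A \<xi> X p)"
proof -
  have "d_form A \<eta> \<xi> X p = g p (\<xi> p) (\<phi> p (X p))"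
    using contact_metric xi_vfield assms unfolding contact_metric_def by meson
  also have "\<dots> = 0"
    using metric_xi_left[OF phi_tangent] eta_phi vfield_tangent[OF assms] by simp
  finally show ?thesis
    using tangent_const[OF vfield_tangent[OF assms], of p 1] by (simp add: d_form_def)
qed

section \<open>The operator h and its relation to \<phi>\<close>

abbreviation h :: "'a vfield \<Rightarrow> 'a vfield"
  where "h \<equiv> h_op A \<phi> \<xi>"

lemma h_apply: "h X p = (1/2) *\<^sub>R (lie_bracket A \<xi> (appl \<phi> X) p - \<phi> p (lie_bracket A \<xi> X p))"
  by (simp add: h_op_def lie_deriv_endo_def scaleR_fun_def)

lemma h_vfield: "X \<in> vfields A \<Longrightarrow> h X \<in> vfields A"
  unfolding h_op_def lie_deriv_endo_def
  by (intro vfield_scaleR vfield_diff lie_bracket_vfield phi_vfield xi_vfield)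

lemma h_tangent: "X \<in> vfields A \<Longrightarrow> h X p \<in> tangent_space A p"
  by (rule vfield_tangent[OF h_vfield])

lemma lie_xi_tangent: "X \<in> vfields A \<Longrightarrow> lie_bracket A \<xi> X p \<in> tangent_space A p"
  by (rule vfield_tangent[OF lie_bracket_vfield[OF xi_vfield]])

lemma h_add:
  assumes "X \<in> vfields A" "Y \<in> vfields A"
  shows "h (X + Y) p = h X p + h Y p"
proof -
  have "appl \<phi> (X + Y) = appl \<phi> X + appl \<phi> Y"
    using phi_add vfield_tangent assms by (simp add: fun_eq_iff)
  then show ?thesis using assms
    by (simp add: h_apply lie_bracket_add_right xi_vfield phi_vfield phi_add lie_xi_tangent algebra_simps)
qed

text \<open>Both brackets in the Lie derivative produce the same term with the derivative of
  \<open>f\<close> along \<xi>, and it cancels in their difference; thus h is a tensor although it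
  is defined on fields.\<close>

lemma h_fmult:
  assumes X: "X \<in> vfields A" and f: "smooth_fun A f"
  shows "h (f \<odot> X) p = f p *\<^sub>R h X p"
proof -
  have 1: "appl \<phi> (f \<odot> X) = f \<odot> appl \<phi> X"
    using phi_scaleR vfield_tangent[OF X] by (simp add: fun_eq_iff)
  have 2: "\<phi> p (lie_bracket A \<xi> (f \<odot> X) p) =
      f p *\<^sub>R \<phi> p (lie_bracket A \<xi> X p) + \<xi> p f *\<^sub>R \<phi> p (X p)"
    using X f subspace_tangent[of p]
    by (simp add: lie_bracket_fmult_right xi_vfield phi_add phi_scaleR lie_xi_tangent
        vfield_tangent subspace_scale)
  show ?thesis
    unfolding h_apply 1 2 using lie_bracket_fmult_right[OF xi_vfield phi_vfield[OF X] f]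
    by (simp add: algebra_simps)
qed

lemma h_xi: "h \<xi> p = 0"
proof -
  \<comment> \<open>Writing the zero field as a multiple of \<xi> lets the product rule compute its
    bracket.\<close>
  have "appl \<phi> \<xi> = (\<lambda>q. 0) \<odot> \<xi>" by (simp add: fun_eq_iff phi_xi)
  then have "lie_bracket A \<xi> (appl \<phi> \<xi>) p = 0"
    using lie_bracket_fmult_right[OF xi_vfield xi_vfield smooth_fun_on_const, of 0]
      tangent_const[OF xi_tangent, of _ 0] by simp
  then show ?thesis by (simp add: h_apply lie_bracket_self phi_zero)
qed

text \<open>Both halves of the Lie derivative are orthogonal to \<xi>: the first because L_\<xi>
  \<eta> = 0 and \<eta>(\<phi>X) vanishes identically, the second as an image of \<phi>.\<close>

lemma eta_h:
  assumes X: "X \<in> vfields A"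
  shows "\<eta> p (h X p) = 0"
proof -
  have "eval1 \<eta> (appl \<phi> X) = (\<lambda>q. 0)"
    using eta_phi vfield_tangent[OF X] by simp
  then have "\<eta> p (lie_bracket A \<xi> (appl \<phi> X) p) = 0"
    using xi_eta[OF phi_vfield[OF X], of p] tangent_const[OF xi_tangent, of p 0] by simp
  moreover have "\<eta> p (\<phi> p (lie_bracket A \<xi> X p)) = 0"
    by (rule eta_phi[OF lie_xi_tangent[OF X]])
  ultimately show ?thesis
    using X subspace_tangent[of p]
    by (simp add: h_apply eta_scaleR eta_diff lie_xi_tangent phi_vfield phi_tangent subspace_diff)
qed

text \<open>The bracket with \<xi> commutes with \<phi>\<phi>, since \<phi>\<phi>X = -X +
  \<eta>(X)\<xi> and both \<eta> and \<xi> are invariant along \<xi>. The product rule for the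
  square then makes h and \<phi> anticommute.\<close>

lemma h_phi:
  assumes X: "X \<in> vfields A"
  shows "h (appl \<phi> X) p = - \<phi> p (h X p)"
proof -
  have 1: "appl \<phi> (appl \<phi> X) = - X + eval1 \<eta> X \<odot> \<xi>"
    using phi_phi vfield_tangent[OF X] by (simp add: fun_eq_iff)
  have 2: "lie_bracket A \<xi> (appl \<phi> (appl \<phi> X)) p =
      - lie_bracket A \<xi> X p + \<eta> p (lie_bracket A \<xi> X p) *\<^sub>R \<xi> p"
  proof -
    have "lie_bracket A \<xi> (- X) = - lie_bracket A \<xi> X"
      using lie_bracket_fmult_right[OF xi_vfield X smooth_fun_on_const, of "-1"]
        tangent_const[OF xi_tangent, of _ "-1"]
      by (simp add: const_fmult)
    then show ?thesis
      using lie_bracket_fmult_right[OF xi_vfield xi_vfield eta_smooth[OF X]]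
      by (simp add: 1 lie_bracket_add_right xi_vfield vfield_uminus vfield_fmult eta_smooth X
          lie_bracket_self xi_eta del: uminus_add_conv_diff)
  qed
  have 3: "\<phi> p (h X p) = (1/2) *\<^sub>R (\<phi> p (lie_bracket A \<xi> (appl \<phi> X) p)
      - \<phi> p (\<phi> p (lie_bracket A \<xi> X p)))"
    using X subspace_tangent[of p]
    by (simp add: h_apply phi_scaleR phi_diff lie_xi_tangent phi_vfield phi_tangent subspace_diff)
  show ?thesis
    unfolding 3 by (simp add: h_apply 2 phi_phi lie_xi_tangent X algebra_simps)
qed

text \<open>h and \<phi>h vanish on \<xi>, so on a frame \<xi>, E, \<phi>E these equations express
  that both are trace-free. They combine anticommutation with the isometry property of
  \<phi>.\<close>

lemma h_trace_cancel:
  assumes X: "X \<in> vfields A"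
  shows "g p (h (appl \<phi> X) p) (\<phi> p (X p)) = - g p (h X p) (X p)"
    and "g p (\<phi> p (h (appl \<phi> X) p)) (\<phi> p (X p)) = - g p (\<phi> p (h X p)) (X p)"
  using X h_tangent[OF X, of p] vfield_tangent[OF X, of p]
  by (simp_all add: h_phi metric_minus_left phi_tangent phi_minus metric_phi_phi eta_h eta_phi)

section \<open>An orthogonal frame from one horizontal field\<close>

context
  fixes E :: "'a vfield"
  assumes E: "E \<in> vfields A" and eta_E: "\<And>q. \<eta> q (E q) = 0" and dim: "DIM('e) = 3"
begin

lemma frame_orthogonal:
  "g q (E q) (\<xi> q) = 0" "g q (\<phi> q (E q)) (\<xi> q) = 0" "g q (E q) (\<phi> q (E q)) = 0"
  "g q (\<phi> q (E q)) (\<phi> q (E q)) = g q (E q) (E q)"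
proof -
  note t = vfield_tangent[OF E, of q]
  show "g q (E q) (\<xi> q) = 0" "g q (\<phi> q (E q)) (\<xi> q) = 0"
    by (simp_all add: metric_xi t phi_tangent eta_E eta_phi)
  show "g q (\<phi> q (E q)) (\<phi> q (E q)) = g q (E q) (E q)"
    by (simp add: metric_phi_phi t eta_E)
  \<comment> \<open>Applying \<phi> to both arguments preserves the product and, by \<phi>\<phi>E =
    -E, also changes its sign.\<close>
  have "g q (E q) (\<phi> q (E q)) = g q (\<phi> q (E q)) (\<phi> q (\<phi> q (E q)))"
    by (simp add: metric_phi_phi t phi_tangent eta_E)
  also have "\<dots> = - g q (E q) (\<phi> q (E q))"
    by (simp add: phi_phi t eta_E metric_minus_right phi_tangent metric_sym[of "\<phi> q (E q)"])
  finally show "g q (E q) (\<phi> q (E q)) = 0" by simp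
qed

text \<open>A nonzero \<open>w\<close> would be a fourth independent vector in a three-dimensional
  tangent space.\<close>

lemma orthogonal_frame_imp_zero:
  assumes w: "w \<in> tangent_space A q" and E0: "E q \<noteq> 0"
    and orth: "g q w (\<xi> q) = 0" "g q w (E q) = 0" "g q w (\<phi> q (E q)) = 0"
  shows "w = 0"
proof (rule ccontr)
  assume "w \<noteq> 0"
  note t = vfield_tangent[OF E, of q]
  note tt = w t phi_tangent[OF t] xi_tangent[of q]
  note o = orth frame_orthogonal[of q]
  note o' = o(1-6)[unfolded metric_sym[OF tt(1) tt(4)] metric_sym[OF tt(1) tt(2)] metric_sym[OF tt(1) tt(3)]
      metric_sym[OF tt(2) tt(4)] metric_sym[OF tt(3) tt(4)] metric_sym[OF tt(2) tt(3)]]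
  have pos: "g q w w > 0" "g q (E q) (E q) > 0" "g q (\<xi> q) (\<xi> q) > 0"
    using metric_pos tt \<open>w \<noteq> 0\<close> E0 xi_nonzero by auto
  let ?S = "{\<xi> q, E q, \<phi> q (E q), w}"
  have ne: "\<phi> q (E q) \<noteq> 0" using o(7) pos(2) metric_zero_left[OF tt(3)] by auto
  \<comment> \<open>Coinciding vectors would shrink the set; they are distinct because they are
    mutually orthogonal and of positive length.\<close>
  have card: "card ?S = 4"
  proof -
    have "\<xi> q \<noteq> E q" "\<xi> q \<noteq> \<phi> q (E q)" "\<xi> q \<noteq> w" "E q \<noteq> \<phi> q (E q)" "E q \<noteq> w" "\<phi> q (E q) \<noteq> w"
      using o pos by auto
    then show ?thesis by auto
  qed
  have "independent ?S"
    by (rule orthogonal_imp_independent[of _ q])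
      (use tt o o' ne \<open>w \<noteq> 0\<close> E0 xi_nonzero[of q] in auto)
  then show False
    using card_independent_tangent_le[of ?S q] tt card dim by simp
qed

lemma frame_expansion:
  assumes X: "X \<in> vfields A"
  shows "eval2 g E E \<odot> X = (\<lambda>q. g q (E q) (E q) * \<eta> q (X q)) \<odot> \<xi>
    + eval2 g X E \<odot> E + eval2 g X (appl \<phi> E) \<odot> appl \<phi> E"
proof
  fix q
  let ?r = "g q (E q) (E q)"
  note t = vfield_tangent[OF E, of q]
  note tt = vfield_tangent[OF X, of q] t phi_tangent[OF t] xi_tangent[of q]
  have "?r *\<^sub>R X q = (?r * \<eta> q (X q)) *\<^sub>R \<xi> q + g q (X q) (E q) *\<^sub>R E q
      + g q (X q) (\<phi> q (E q)) *\<^sub>R \<phi> q (E q)"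
  proof (cases "E q = 0")
    case True
    then show ?thesis by (simp add: phi_zero metric_zero_left[OF subspace_0[OF subspace_tangent]])
  next
    case False
    let ?u = "(?r * \<eta> q (X q)) *\<^sub>R \<xi> q" and ?v = "g q (X q) (E q) *\<^sub>R E q"
      and ?w = "g q (X q) (\<phi> q (E q)) *\<^sub>R \<phi> q (E q)"
    note s = subspace_tangent[of q]
    note m = subspace_scale[OF s] subspace_add[OF s] subspace_diff[OF s] tt
    note o = frame_orthogonal[of q]
    have lin: "g q (?r *\<^sub>R X q - (?u + ?v + ?w)) z = ?r * g q (X q) z - (?r * \<eta> q (X q) * g q (\<xi> q) z
        + g q (X q) (E q) * g q (E q) z + g q (X q) (\<phi> q (E q)) * g q (\<phi> q (E q)) z)"
      if "z \<in> tangent_space A q" for z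
      using that by (simp add: metric_diff_left metric_add_left metric_scaleR_left m)
    have "?r *\<^sub>R X q - (?u + ?v + ?w) = 0"
    proof (rule orthogonal_frame_imp_zero[OF _ False])
      show "?r *\<^sub>R X q - (?u + ?v + ?w) \<in> tangent_space A q" by (intro m)
      show "g q (?r *\<^sub>R X q - (?u + ?v + ?w)) (\<xi> q) = 0"
        using o by (simp add: lin tt metric_xi)
      show "g q (?r *\<^sub>R X q - (?u + ?v + ?w)) (E q) = 0"
        using o(3) metric_sym[OF tt(2,3)] by (simp add: lin tt metric_xi_left eta_E)
      show "g q (?r *\<^sub>R X q - (?u + ?v + ?w)) (\<phi> q (E q)) = 0"
        using o(3,4) by (simp add: lin tt metric_xi_left eta_phi)
    qed
    then show ?thesis by simp
  qed
  then show "(eval2 g E E \<odot> X) q = ((\<lambda>q. g q (E q) (E q) * \<eta> q (X q)) \<odot> \<xi>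
    + eval2 g X E \<odot> E + eval2 g X (appl \<phi> E) \<odot> appl \<phi> E) q" by simp
qed

lemma phi_frame:
  assumes unit: "g p (E p) (E p) = 1"
  shows "tensor_frame A g D p 3 (\<lambda>i. if i = 0 then \<xi> else if i = 1 then E else appl \<phi> E)"
proof
  note t = vfield_tangent[OF E, of p]
  note o = frame_orthogonal[of p] unit
  fix i j :: nat
  show "(if i = 0 then \<xi> else if i = 1 then E else appl \<phi> E) \<in> vfields A"
    by (simp add: xi_vfield E phi_vfield)
  show "g p ((if i = 0 then \<xi> else if i = 1 then E else appl \<phi> E) p)
      ((if j = 0 then \<xi> else if j = 1 then E else appl \<phi> E) p) = (if i = j then 1 else 0)"
    if "i < 3" "j < 3"
    using that o metric_sym[OF t xi_tangent] metric_sym[OF phi_tangent[OF t] xi_tangent]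
      metric_sym[OF t phi_tangent[OF t]] metric_xi[OF xi_tangent, of p]
    by auto
next
  fix T :: "'a vfield \<Rightarrow> 'a tvec" and X
  assume T: "tensorial_at A p T" and X: "X \<in> vfields A"
  let ?a = "\<lambda>q. g q (E q) (E q) * \<eta> q (X q)"
  note sm = smooth_fun_on_mult[OF open_UNIV metric_smooth[OF E E] eta_smooth[OF X]]
    metric_smooth[OF X E] metric_smooth[OF X phi_vfield[OF E]] metric_smooth[OF E E]
  \<comment> \<open>The factor g(E,E) is 1 at \<open>p\<close>, so a tensorial operator does not
    notice it, and the multiplied field has an expansion with globally smooth coefficients.\<close>
  have "T X = T (eval2 g E E \<odot> X)"
    using T X sm(4) unit by (simp add: tensorial_at_def)
  also have "\<dots> = T (?a \<odot> \<xi> + eval2 g X E \<odot> E + eval2 g X (appl \<phi> E) \<odot> appl \<phi> E)"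
    by (simp only: frame_expansion[OF X])
  also have "\<dots> = \<eta> p (X p) *\<^sub>R T \<xi> + g p (X p) (E p) *\<^sub>R T E
      + g p (X p) (\<phi> p (E p)) *\<^sub>R T (appl \<phi> E)"
    using T sm unit by (simp add: tensorial_at_def vfield_add vfield_fmult xi_vfield E phi_vfield)
  finally show "T X = (\<Sum>i<3::nat. g p (X p) ((if i = 0 then \<xi> else if i = 1 then E else appl \<phi> E) p) *\<^sub>R
      T (if i = 0 then \<xi> else if i = 1 then E else appl \<phi> E))"
    by (simp add: numeral_3_eq_3 metric_xi vfield_tangent[OF X])
qed

end

lemma obtain_horizontal_unit:
  assumes "DIM('e) > 1"
  obtains E where "E \<in> vfields A" "\<And>q. \<eta> q (E q) = 0" "g p (E p) (E p) = 1"
proof -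
  obtain B where B: "independent B" "B \<subseteq> tangent_space A p" "finite B" "card B = DIM('e)"
    by (rule obtain_independent_tangent)
  have "\<not> B \<subseteq> span {\<xi> p}"
    using independent_span_bound[OF _ B(1), of "{\<xi> p}"] B(4) assms by auto
  then obtain v where v: "v \<in> B" "v \<notin> span {\<xi> p}" by blast
  then obtain V where V: "V \<in> vfields A" "V p = v" using extend_tangent_vector[of v p] B(2) by blast
  \<comment> \<open>Removing the \<xi>-component makes the field horizontal everywhere; at
    \<open>p\<close> it stays nonzero because \<open>v\<close> is not a multiple of \<xi>.\<close>
  define N where "N = V - eval1 \<eta> V \<odot> \<xi>"
  have N: "N \<in> vfields A"
    unfolding N_def by (intro vfield_diff vfield_fmult eta_smooth xi_vfield V(1))
  have eta_N: "\<eta> q (N q) = 0" for q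
    using vfield_tangent[OF V(1), of q] xi_tangent[of q]
    by (simp add: N_def eta_diff eta_scaleR subspace_scale[OF subspace_tangent])
  have "N p \<noteq> 0"
  proof
    assume "N p = 0"
    then have "v = \<eta> p v *\<^sub>R \<xi> p" by (simp add: N_def V(2))
    also have "\<dots> \<in> span {\<xi> p}" by (intro span_scale span_base) simp
    finally show False using v(2) by simp
  qed
  then have pos: "g p (N p) (N p) > 0" by (rule metric_pos[OF vfield_tangent[OF N]])
  \<comment> \<open>The scaling factor is a constant, since \<open>N\<close> may vanish away from
    \<open>p\<close>; unit length is obtained at \<open>p\<close> only.\<close>
  define E where "E = (1 / sqrt (g p (N p) (N p))) *\<^sub>R N"
  show ?thesis
  proof
    show "E \<in> vfields A" unfolding E_def by (rule vfield_scaleR[OF N])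
    show "\<eta> q (E q) = 0" for q
      using eta_N by (simp add: E_def scaleR_fun_apply eta_scaleR[OF vfield_tangent[OF N]])
    show "g p (E p) (E p) = 1"
      using pos by (simp add: E_def scaleR_fun_apply metric_scaleR_left metric_scaleR_right vfield_tangent[OF N]
          subspace_scale[OF subspace_tangent])
  qed
qed

end

section \<open>Curvature in dimension three\<close>

text \<open>Applied once to the first and once to the second pair of indices of the curvature
  components, it leaves only the entries above the diagonal to be compared.\<close>

lemma skew_eq_on_3:
  fixes a b :: "nat \<Rightarrow> nat \<Rightarrow> real"
  assumes "\<And>i j. i < 3 \<Longrightarrow> j < 3 \<Longrightarrow> a i j = - a j i" "\<And>i j. i < 3 \<Longrightarrow> j < 3 \<Longrightarrow> b i j = - b j i"
    and "a 0 1 = b 0 1" "a 0 2 = b 0 2" "a 1 2 = b 1 2" "i < 3" "j < 3"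
  shows "a i j = b i j"
proof -
  have "a 0 0 = b 0 0" "a 1 1 = b 1 1" "a 2 2 = b 2 2"
    "a 1 0 = b 1 0" "a 2 0 = b 2 0" "a 2 1 = b 2 1"
    using assms(1)[of 0 0] assms(1)[of 1 1] assms(1)[of 2 2] assms(2)[of 0 0] assms(2)[of 1 1] assms(2)[of 2 2]
      assms(1)[of 1 0] assms(1)[of 2 0] assms(1)[of 2 1] assms(2)[of 1 0] assms(2)[of 2 0] assms(2)[of 2 1]
      assms(3-5) by auto
  moreover have "i = 0 \<or> i = 1 \<or> i = 2" "j = 0 \<or> j = 1 \<or> j = 2" using assms(6,7) by auto
  ultimately show ?thesis using assms(3-5) by auto
qed

context tensor_frame
begin

lemma tensorial_eqI:
  fixes S T :: "'a vfield \<Rightarrow> 'a tvec"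
  assumes "tensorial_at A p S" "tensorial_at A p T" "X \<in> vfields A" "\<And>i. i < n \<Longrightarrow> S (E i) = T (E i)"
  shows "S X = T X"
  using expand[OF assms(1,3)] expand[OF assms(2,3)] assms(4) by simp

lemma tangent_eqI:
  assumes "u \<in> tangent_space A p" "v \<in> tangent_space A p"
    and "\<And>i. i < n \<Longrightarrow> g p u (E i p) = g p v (E i p)"
  shows "u = v"
proof -
  have "u = (\<Sum>i<n. g p u (E i p) *\<^sub>R E i p)" by (rule expand_tangent[OF assms(1)])
  also have "\<dots> = (\<Sum>i<n. g p v (E i p) *\<^sub>R E i p)" using assms(3) by simp
  also have "\<dots> = v" by (rule expand_tangent[OF assms(2), symmetric])
  finally show ?thesis .
qed

end

locale kappa_mu_nu_mfd = contact_metric_mfd A g D \<phi> \<xi> \<eta>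
  for A :: "('a::{t2_space, second_countable_topology}, 'e::euclidean_space) atlas"
    and g :: "'a bilin_field" and D :: "'a connection"
    and \<phi> :: "'a endo_field" and \<xi> :: "'a vfield" and \<eta> :: "'a form_field" +
  fixes \<kappa> \<mu> \<nu> :: "'a \<Rightarrow> real"
  assumes kappa_mu_nu: "kappa_mu_nu_contact_metric A \<phi> \<xi> \<eta> g D \<kappa> \<mu> \<nu>"
    and dim_3: "DIM('e) = 3"
begin

abbreviation R_formula :: "('a \<Rightarrow> real) \<Rightarrow> ('a \<Rightarrow> real) \<Rightarrow> 'a vfield \<Rightarrow> 'a vfield \<Rightarrow> 'a vfield \<Rightarrow> 'a vfield"
  where "R_formula a b X Y Z \<equiv>
    a \<odot> R1 g X Y Z + b \<odot> R3 \<xi> \<eta> g X Y Z + \<mu> \<odot> R4 A \<phi> \<xi> g X Y Z + \<nu> \<odot> R7 A \<phi> \<xi> g X Y Z"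

lemma curvature_xi:
  assumes "X \<in> vfields A" "Y \<in> vfields A"
  shows "R X Y \<xi> p = \<kappa> p *\<^sub>R (\<eta> p (Y p) *\<^sub>R X p - \<eta> p (X p) *\<^sub>R Y p)
    + \<mu> p *\<^sub>R (\<eta> p (Y p) *\<^sub>R h X p - \<eta> p (X p) *\<^sub>R h Y p)
    + \<nu> p *\<^sub>R (\<eta> p (Y p) *\<^sub>R \<phi> p (h X p) - \<eta> p (X p) *\<^sub>R \<phi> p (h Y p))"
proof -
  have "R X Y \<xi> = \<kappa> \<odot> (eval1 \<eta> Y \<odot> X - eval1 \<eta> X \<odot> Y)
       + \<mu> \<odot> (eval1 \<eta> Y \<odot> h X - eval1 \<eta> X \<odot> h Y)
       + \<nu> \<odot> (eval1 \<eta> Y \<odot> appl \<phi> (h X) - eval1 \<eta> X \<odot> appl \<phi> (h Y))"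
    using kappa_mu_nu assms unfolding kappa_mu_nu_contact_metric_def Let_def by meson
  from fun_cong[OF this, of p] show ?thesis by simp
qed

lemma R_formula_apply:
  "R_formula a b X Y Z p =
    a p *\<^sub>R (g p (Y p) (Z p) *\<^sub>R X p - g p (X p) (Z p) *\<^sub>R Y p)
    + b p *\<^sub>R ((\<eta> p (X p) * \<eta> p (Z p)) *\<^sub>R Y p - (\<eta> p (Y p) * \<eta> p (Z p)) *\<^sub>R X p
        + (g p (X p) (Z p) * \<eta> p (Y p)) *\<^sub>R \<xi> p - (g p (Y p) (Z p) * \<eta> p (X p)) *\<^sub>R \<xi> p)
    + \<mu> p *\<^sub>R (g p (Y p) (Z p) *\<^sub>R h X p - g p (X p) (Z p) *\<^sub>R h Y p
        + g p (h Y p) (Z p) *\<^sub>R X p - g p (h X p) (Z p) *\<^sub>R Y p)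
    + \<nu> p *\<^sub>R (g p (Y p) (Z p) *\<^sub>R \<phi> p (h X p) - g p (X p) (Z p) *\<^sub>R \<phi> p (h Y p)
        + g p (\<phi> p (h Y p)) (Z p) *\<^sub>R X p - g p (\<phi> p (h X p)) (Z p) *\<^sub>R Y p)"
  by (simp add: R1_def R3_def R4_def R7_def Let_def)

lemma R_formula_tangent:
  assumes "X \<in> vfields A" "Y \<in> vfields A"
  shows "R_formula a b X Y Z p \<in> tangent_space A p"
  unfolding R_formula_apply
  by (intro subspace_add[OF subspace_tangent] subspace_diff[OF subspace_tangent]
      subspace_scale[OF subspace_tangent] phi_tangent h_tangent assms vfield_tangent[OF assms(1)]
      vfield_tangent[OF assms(2)] xi_tangent)

lemma tensorial_R_formula:
  assumes Y: "Y \<in> vfields A" and Z: "Z \<in> vfields A"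
  shows "tensorial_at A p (\<lambda>X. R_formula a b X Y Z p)" "tensorial_at A p (\<lambda>X. R_formula a b Y X Z p)"
    "tensorial_at A p (\<lambda>X. R_formula a b Y Z X p)"
proof -
  note rules = h_add h_fmult phi_add phi_scaleR eta_add eta_scaleR metric_add_left metric_add_right
    metric_scaleR_left metric_scaleR_right vfield_tangent h_vfield phi_tangent Y Z
    subspace_scale[OF subspace_tangent] vfield_add vfield_fmult
  show "tensorial_at A p (\<lambda>X. R_formula a b X Y Z p)"
    unfolding tensorial_at_def R_formula_apply by (auto simp: rules algebra_simps)
  show "tensorial_at A p (\<lambda>X. R_formula a b Y X Z p)"
    unfolding tensorial_at_def R_formula_apply by (auto simp: rules algebra_simps)
  show "tensorial_at A p (\<lambda>X. R_formula a b Y Z X p)"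
    unfolding tensorial_at_def R_formula_apply by (auto simp: rules algebra_simps)
qed

lemma metric_curvature_xi:
  assumes X: "X \<in> vfields A" and Y: "Y \<in> vfields A" and v: "v \<in> tangent_space A p"
  shows "g p (R X Y \<xi> p) v = \<kappa> p * (\<eta> p (Y p) * g p (X p) v - \<eta> p (X p) * g p (Y p) v)
    + \<mu> p * (\<eta> p (Y p) * g p (h X p) v - \<eta> p (X p) * g p (h Y p) v)
    + \<nu> p * (\<eta> p (Y p) * g p (\<phi> p (h X p)) v - \<eta> p (X p) * g p (\<phi> p (h Y p)) v)"
  unfolding curvature_xi[OF X Y]
  using v subspace_tangent[of p] vfield_tangent[OF X, of p] vfield_tangent[OF Y, of p]
    h_tangent[OF X, of p] h_tangent[OF Y, of p]
    phi_tangent[OF h_tangent[OF X, of p]] phi_tangent[OF h_tangent[OF Y, of p]]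
  by (simp add: metric_add_left metric_diff_left metric_scaleR_left subspace_add subspace_diff subspace_scale)

lemma metric_R_formula:
  assumes X: "X \<in> vfields A" and Y: "Y \<in> vfields A" and v: "v \<in> tangent_space A p"
  shows "g p (R_formula a b X Y Z p) v =
    a p * (g p (Y p) (Z p) * g p (X p) v - g p (X p) (Z p) * g p (Y p) v)
    + b p * (\<eta> p (X p) * \<eta> p (Z p) * g p (Y p) v - \<eta> p (Y p) * \<eta> p (Z p) * g p (X p) v
        + g p (X p) (Z p) * \<eta> p (Y p) * \<eta> p v - g p (Y p) (Z p) * \<eta> p (X p) * \<eta> p v)
    + \<mu> p * (g p (Y p) (Z p) * g p (h X p) v - g p (X p) (Z p) * g p (h Y p) v
        + g p (h Y p) (Z p) * g p (X p) v - g p (h X p) (Z p) * g p (Y p) v)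
    + \<nu> p * (g p (Y p) (Z p) * g p (\<phi> p (h X p)) v - g p (X p) (Z p) * g p (\<phi> p (h Y p)) v
        + g p (\<phi> p (h Y p)) (Z p) * g p (X p) v - g p (\<phi> p (h X p)) (Z p) * g p (Y p) v)"
  unfolding R_formula_apply
  using v subspace_tangent[of p] vfield_tangent[OF X, of p] vfield_tangent[OF Y, of p]
    h_tangent[OF X, of p] h_tangent[OF Y, of p] xi_tangent[of p]
    phi_tangent[OF h_tangent[OF X, of p]] phi_tangent[OF h_tangent[OF Y, of p]]
  by (simp add: metric_add_left metric_diff_left metric_scaleR_left metric_xi_left
      subspace_add subspace_diff subspace_scale)

text \<open>Here \<tau> is a number, the scalar curvature at the point of comparison, so the
  coefficients are functions that need to be right at \<open>p\<close> only.\<close>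

lemma curvature_eq_R_formula:
  assumes X: "X \<in> vfields A" and Y: "Y \<in> vfields A" and Z: "Z \<in> vfields A"
    and \<tau>: "\<tau> = scalar_curvature A g D p"
  shows "R X Y Z p = R_formula (\<lambda>p. \<tau> / 2 - 2 * \<kappa> p) (\<lambda>p. \<tau> / 2 - 3 * \<kappa> p) X Y Z p"
proof -
  obtain E1 where E1: "E1 \<in> vfields A" "\<And>q. \<eta> q (E1 q) = 0" "g p (E1 p) (E1 p) = 1"
    using obtain_horizontal_unit[of p] dim_3 by auto
  define E where "E = (\<lambda>i::nat. if i = 0 then \<xi> else if i = 1 then E1 else appl \<phi> E1)"
  interpret tensor_frame A g D p 3 E
    unfolding E_def by (rule phi_frame[OF E1(1,2) dim_3 E1(3)])
  let ?S = "R_formula (\<lambda>p. \<tau> / 2 - 2 * \<kappa> p) (\<lambda>p. \<tau> / 2 - 3 * \<kappa> p)"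
  have t: "E i p \<in> tangent_space A p" for i by (rule vfield_tangent[OF frame])
  have E012: "E 0 = \<xi>" "E 1 = E1" "E 2 = appl \<phi> E1" by (simp_all add: E_def)
  have eta: "\<eta> p (E i p) = (if i = 0 then 1 else 0)" for i
    using E1(2) eta_phi[OF vfield_tangent[OF E1(1)]] by (simp add: E_def)
  define H where "H i j = g p (h (E i) p) (E j p)" for i j
  define K where "K i j = g p (\<phi> p (h (E i) p)) (E j p)" for i j
  define r where "r i j k l = g p (R (E i) (E j) (E k) p) (E l p)" for i j k l
  define s where "s i j k l = g p (?S (E i) (E j) (E k) p) (E l p)" for i j k l
  have H0: "H 0 i = 0" "H i 0 = 0" and K0: "K 0 i = 0" "K i 0 = 0" for i
    using h_xi[of p] eta_h[OF frame] eta_phi[OF h_tangent[OF frame]]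
    by (simp_all add: H_def K_def E012 metric_xi h_tangent phi_tangent frame phi_zero metric_zero_left t)
  have HK2: "H 2 2 = - H 1 1" "K 2 2 = - K 1 1"
    using h_trace_cancel[OF E1(1), of p] unfolding H_def K_def E012 by simp_all
  have rxi: "r i j 0 l = \<kappa> p * (\<eta> p (E j p) * g p (E i p) (E l p) - \<eta> p (E i p) * g p (E j p) (E l p))
    + \<mu> p * (\<eta> p (E j p) * H i l - \<eta> p (E i p) * H j l)
    + \<nu> p * (\<eta> p (E j p) * K i l - \<eta> p (E i p) * K j l)" for i j l
    unfolding r_def H_def K_def E012 by (rule metric_curvature_xi[OF frame frame t])
  have r1: "r i j k l = - r j i k l" and r2: "r i j k l = - r i j l k" and r3: "r i j k l = r k l i j"
    for i j k l
    unfolding r_def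
    by (rule curvature_swap_metric curvature_metric_skew curvature_pair_sym; rule frame)+
  \<comment> \<open>Of the nine terms the three diagonal ones vanish by skewness, and pair symmetry
    matches the other six in twos.\<close>
  have "\<tau> = (\<Sum>i<3. \<Sum>j<3. r j i i j)"
    unfolding \<tau> scalar_curvature_frame r_def ..
  also have "\<dots> = r 0 0 0 0 + r 1 0 0 1 + r 2 0 0 2 + (r 0 1 1 0 + r 1 1 1 1 + r 2 1 1 2)
      + (r 0 2 2 0 + r 1 2 2 1 + r 2 2 2 2)"
    by (simp add: numeral_3_eq_3 numeral_2_eq_2)
  also have "\<dots> = 2 * (r 1 0 0 1 + r 2 0 0 2 + r 1 2 2 1)"
    using r1[of 0 0 0 0] r1[of 1 1 1 1] r1[of 2 2 2 2] r3[of 1 0 0 1] r3[of 2 0 0 2] r3[of 1 2 2 1] by simp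
  \<comment> \<open>Each of the two terms is \<kappa> plus \<mu> and \<nu> times a diagonal entry of
    \<open>H\<close> and \<open>K\<close>; these entries cancel by \<open>HK2\<close>.\<close>
  also have "r 1 0 0 1 + r 2 0 0 2 = 2 * \<kappa> p"
    using HK2 by (simp add: rxi eta orthonormal algebra_simps)
  finally have K: "r 1 2 2 1 = \<tau> / 2 - 2 * \<kappa> p" by (simp add: field_simps)
  note s = s_def[unfolded metric_R_formula[OF frame frame t], folded H_def K_def]
  \<comment> \<open>In components \<open>R4\<close> and \<open>R7\<close> have the shape of
    Kulkarni-Nomizu products of the metric with \<open>H\<close> and \<open>K\<close>, so both skew
    symmetries are algebraic identities.\<close>
  have s1: "s i j k l = - s j i k l" and s2: "s i j k l = - s i j l k" for i j k l
    unfolding s using metric_sym[OF t t, of k l] by (simp_all add: algebra_simps)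
  note ev = eta orthonormal H0 K0 HK2
  have rs: "r i j k l = s i j k l" if "i < 3" "j < 3" "k < 3" "l < 3" for i j k l
  proof -
    have xi: "r i j 0 l = s i j 0 l" if "i < 3" "j < 3" "l < 3" for i j l
      unfolding rxi s using that by (auto simp: ev algebra_simps)
    have "r i j 1 2 = s i j 1 2"
    proof (rule skew_eq_on_3[of "\<lambda>i j. r i j 1 2" "\<lambda>i j. s i j 1 2", OF r1 s1 _ _ _ that(1,2)])
      \<comment> \<open>Pair symmetry moves the index 0 of \<xi> into third place, where
        \<open>rxi\<close> applies.\<close>
      show "r 0 1 1 2 = s 0 1 1 2" "r 0 2 1 2 = s 0 2 1 2"
        unfolding r3[of 0] rxi s by (simp_all add: ev)
      \<comment> \<open>On horizontal arguments \<open>R3\<close> vanishes and \<open>R4\<close>,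
        \<open>R7\<close> contribute the traces of h and \<phi>h, which are 0; only the coefficient
        of \<open>R1\<close> is left.\<close>
      show "r 1 2 1 2 = s 1 2 1 2"
        using K unfolding r2[of 1 2 1 2] s by (simp add: ev algebra_simps)
    qed
    then show ?thesis
      using skew_eq_on_3[of "r i j" "s i j", OF r2 s2 _ _ _ that(3,4)] xi[OF that(1,2)] by simp
  qed
  have frame_eq: "R (E i) (E j) (E k) p = ?S (E i) (E j) (E k) p" if "i < 3" "j < 3" "k < 3" for i j k
    by (rule tangent_eqI[OF vfield_tangent[OF curvature_vfield] R_formula_tangent,
          OF frame frame frame frame frame rs[OF that, unfolded r_def s_def]])
  \<comment> \<open>The frame fields are replaced by arbitrary fields one argument at a time, the
    last argument first.\<close>
  have "R (E i) (E j) Z p = ?S (E i) (E j) Z p" if "i < 3" "j < 3" for i j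
    by (rule tensorial_eqI[OF tensorial_curvature(3)[OF frame frame] tensorial_R_formula(3)[OF frame frame] Z])
      (rule frame_eq[OF that])
  then have "R (E i) Y Z p = ?S (E i) Y Z p" if "i < 3" for i
    using that
    by (intro tensorial_eqI[OF tensorial_curvature(2)[OF frame Z] tensorial_R_formula(2)[OF frame Z] Y])
  then show ?thesis
    by (rule tensorial_eqI[OF tensorial_curvature(1)[OF Y Z] tensorial_R_formula(1)[OF Y Z] X])
qed

end

theorem theorem3p1:
  fixes A :: "('a::{t2_space, second_countable_topology}, real ^ 3) atlas"
    and \<phi> :: "'a endo_field" and \<xi> :: "'a vfield" and \<eta> :: "'a form_field"
    and g :: "'a bilin_field" and D :: "'a connection"
    and \<kappa> \<mu> \<nu> \<tau> :: "'a \<Rightarrow> real"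
  assumes "levi_civita A g D"
    and "kappa_mu_nu_contact_metric A \<phi> \<xi> \<eta> g D \<kappa> \<mu> \<nu>"
    and "\<forall>p. \<kappa> p < 1"
    and "\<tau> = scalar_curvature A g D"
  shows "\<forall>X\<in>vfields A. \<forall>Y\<in>vfields A. \<forall>Z\<in>vfields A.
    curvature A D X Y Z =
        (\<lambda>p. \<tau> p / 2 - 2 * \<kappa> p) \<odot> R1 g X Y Z
      + (\<lambda>p. \<tau> p / 2 - 3 * \<kappa> p) \<odot> R3 \<xi> \<eta> g X Y Z
      + \<mu> \<odot> R4 A \<phi> \<xi> g X Y Z
      + \<nu> \<odot> R7 A \<phi> \<xi> g X Y Z"
proof -
  have C: "contact_metric A \<phi> \<xi> \<eta> g"
    using assms(2) by (simp add: kappa_mu_nu_contact_metric_def)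
  then have "smooth_manifold A" "riemannian_metric A g"
    by (simp_all add: contact_metric_def almost_contact_metric_def)
  then interpret kappa_mu_nu_mfd A g D \<phi> \<xi> \<eta> \<kappa> \<mu> \<nu>
    using assms(1,2) C by unfold_locales simp_all
  show ?thesis
  proof (intro ballI ext)
    fix X Y Z p f
    assume "X \<in> vfields A" "Y \<in> vfields A" "Z \<in> vfields A"
    \<comment> \<open>Both sides are compared at \<open>p\<close>, where a coefficient counts only
      by its value, so the function \<tau> may be frozen at \<open>p\<close>.\<close>
    then have "R X Y Z p = R_formula (\<lambda>q. \<tau> p / 2 - 2 * \<kappa> q) (\<lambda>q. \<tau> p / 2 - 3 * \<kappa> q) X Y Z p"
      using assms(4) by (intro curvature_eq_R_formula) simp_all
    also have "\<dots> = R_formula (\<lambda>p. \<tau> p / 2 - 2 * \<kappa> p) (\<lambda>p. \<tau> p / 2 - 3 * \<kappa> p) X Y Z p"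
      by simp
    finally show "R X Y Z p f = R_formula (\<lambda>p. \<tau> p / 2 - 2 * \<kappa> p) (\<lambda>p. \<tau> p / 2 - 3 * \<kappa> p) X Y Z p f"
      by (rule fun_cong)
  qed
qed

end
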